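(* Let $t\in[0,1)$ and $p\in[1,\infty)$. The operator $\mathcal{C}_t\in\mathcal{L}(d_p)$ satisfies $\|\mathcal{C}_t\|_{d_p\to d_p}\le(1-t)^{-1-(1/p)}$, is compact and has spectrum $\sigma(\mathcal{C}_t;d_p)=\Lambda\cup\{0\}$. Moreover, the fine spectra of $\mathcal{C}_t$ are given by $$\sigma_{\mathrm p}(\mathcal{C}_t;d_p)=\Lambda,\quad \sigma_{\mathrm c}(\mathcal{C}_t;d_p)=\{0\},\quad \sigma_{\mathrm r}(\mathcal{C}_t;d_p)=\emptyset.$$
   Context: Let $\mathbb{N}_0=\{0,1,2,\dots\}$ and $\Lambda:=\{1/(n+1):n\in\mathbb{N}_0\}$. For $t\in[0,1]$ the generalized Cesàro operator on $\mathbb{C}^{\mathbb{N}_0}$ is $(\mathcal{C}_tx)_n=\frac{1}{n+1}\sum_{k=0}^n t^{n-k}x_k$ (with $0^0=1$). $\mathcal{C}_t\in\mathcal{L}(X)$ means that it maps $X$ continuously into itself; the restriction is also denoted $\mathcal{C}_t$. For $p\in[1,\infty)$, $d_p:=\{x\in\ell^\infty:\hat x\in\ell^p\}$, where $\hat x:=(\sup_{k\ge n}|x_k|)_{n\ge0}$ is the least decreasing majorant of $x$, with norm $\|x\|_{d_p}:=\|\hat x\|_p$ (the $\ell^p$-norm of $\hat x$); it is a Banach space. $\mathcal{L}(X)$ is the space of continuous linear operators on $X$. For $T\in\mathcal{L}(X)$: $\sigma(T;X)$ is the set of $\lambda\in\mathbb{C}$ with $T-\lambda I$ not invertible in $\mathcal{L}(X)$;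 $\sigma_{\mathrm p}(T;X)$ is the set of $\lambda$ with $T-\lambda I$ not injective; $\sigma_{\mathrm c}(T;X)$ is the set of $\lambda$ with $T-\lambda I$ injective and range a proper dense subspace of $X$; $\sigma_{\mathrm r}(T;X)$ is the set of $\lambda$ with $T-\lambda I$ injective and range not dense in $X$. *)

theory Defs
  imports "HOL-Analysis.Analysis"
begin

section \<open>Normed spaces of complex sequences and their operators\<close>

text \<open>
  The spaces \<open>d\<^sub>p\<close> depend on a real parameter, so a normed space of complex sequences is
  represented by a carrier \<open>X\<close>, closed under the pointwise vector space operations, together with
  a norm \<open>N\<close> on \<open>X\<close>. An operator on \<open>X\<close> is a function on all sequences of which only
  the restriction to \<open>X\<close> matters.
\<close>

type_synonym cseq = "nat \<Rightarrow> complex"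

definition norm_topology :: "cseq set \<Rightarrow> (cseq \<Rightarrow> real) \<Rightarrow> cseq topology" where
  "norm_topology X N = Metric_space.mtopology X (\<lambda>x y. N (\<lambda>n. x n - y n))"

definition continuous_linear_operators ::
    "cseq set \<Rightarrow> (cseq \<Rightarrow> real) \<Rightarrow> (cseq \<Rightarrow> cseq) set" where
  "continuous_linear_operators X N = {T.
     T ` X \<subseteq> X \<and>
     (\<forall>x\<in>X. \<forall>y\<in>X. T (\<lambda>n. x n + y n) = (\<lambda>n. T x n + T y n)) \<and>
     (\<forall>c. \<forall>x\<in>X. T (\<lambda>n. c * x n) = (\<lambda>n. c * T x n)) \<and>
     continuous_map (norm_topology X N) (norm_topology X N) T}"

text \<open>The supremum is taken in the reals, so it is the operator norm only for continuous
  linear \<open>T\<close>, where the set is bounded.\<close>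

definition operator_norm :: "cseq set \<Rightarrow> (cseq \<Rightarrow> real) \<Rightarrow> (cseq \<Rightarrow> cseq) \<Rightarrow> real" where
  "operator_norm X N T = (SUP x\<in>{x \<in> X. N x \<le> 1}. N (T x))"

definition compact_operator :: "cseq set \<Rightarrow> (cseq \<Rightarrow> real) \<Rightarrow> (cseq \<Rightarrow> cseq) \<Rightarrow> bool" where
  "compact_operator X N T \<longleftrightarrow>
     T \<in> continuous_linear_operators X N \<and>
     compactin (norm_topology X N) (norm_topology X N closure_of (T ` {x \<in> X. N x \<le> 1}))"

definition shifted_operator :: "(cseq \<Rightarrow> cseq) \<Rightarrow> complex \<Rightarrow> cseq \<Rightarrow> cseq" where
  "shifted_operator T \<mu> x = (\<lambda>n. T x n - \<mu> * x n)"

definition invertible_operator :: "cseq set \<Rightarrow> (cseq \<Rightarrow> real) \<Rightarrow> (cseq \<Rightarrow> cseq) \<Rightarrow> bool" where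
  "invertible_operator X N T \<longleftrightarrow>
     (\<exists>S \<in> continuous_linear_operators X N. \<forall>x\<in>X. S (T x) = x \<and> T (S x) = x)"

definition spectrum :: "cseq set \<Rightarrow> (cseq \<Rightarrow> real) \<Rightarrow> (cseq \<Rightarrow> cseq) \<Rightarrow> complex set" where
  "spectrum X N T = {\<mu>. \<not> invertible_operator X N (shifted_operator T \<mu>)}"

definition point_spectrum :: "cseq set \<Rightarrow> (cseq \<Rightarrow> cseq) \<Rightarrow> complex set" where
  "point_spectrum X T = {\<mu>. \<not> inj_on (shifted_operator T \<mu>) X}"

definition continuous_spectrum :: "cseq set \<Rightarrow> (cseq \<Rightarrow> real) \<Rightarrow> (cseq \<Rightarrow> cseq) \<Rightarrow> complex set" where
  "continuous_spectrum X N T = {\<mu>.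
     inj_on (shifted_operator T \<mu>) X \<and>
     shifted_operator T \<mu> ` X \<noteq> X \<and>
     norm_topology X N closure_of (shifted_operator T \<mu> ` X) = X}"

definition residual_spectrum :: "cseq set \<Rightarrow> (cseq \<Rightarrow> real) \<Rightarrow> (cseq \<Rightarrow> cseq) \<Rightarrow> complex set" where
  "residual_spectrum X N T = {\<mu>.
     inj_on (shifted_operator T \<mu>) X \<and>
     norm_topology X N closure_of (shifted_operator T \<mu> ` X) \<noteq> X}"

section \<open>The spaces \<open>d\<^sub>p\<close>\<close>

definition lp_space :: "real \<Rightarrow> (nat \<Rightarrow> 'a::real_normed_vector) set" where
  "lp_space p = {x. summable (\<lambda>n. norm (x n) powr p)}"

definition lp_norm :: "real \<Rightarrow> (nat \<Rightarrow> 'a::real_normed_vector) \<Rightarrow> real" where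
  "lp_norm p x = (\<Sum>n. norm (x n) powr p) powr (1 / p)"

definition linf_space :: "(nat \<Rightarrow> 'a::real_normed_vector) set" where
  "linf_space = {x. bounded (range x)}"

definition least_decreasing_majorant :: "cseq \<Rightarrow> nat \<Rightarrow> real" where
  "least_decreasing_majorant x n = (SUP k\<in>{n..}. norm (x k))"

definition d_space :: "real \<Rightarrow> cseq set" where
  "d_space p = {x \<in> linf_space. least_decreasing_majorant x \<in> lp_space p}"

definition d_norm :: "real \<Rightarrow> cseq \<Rightarrow> real" where
  "d_norm p x = lp_norm p (least_decreasing_majorant x)"

section \<open>Generalized Cesaro operators\<close>

definition cesaro :: "real \<Rightarrow> cseq \<Rightarrow> cseq" where
  "cesaro t x n = 1 / of_nat (n + 1) * (\<Sum>k=0..n. of_real t ^ (n - k) * x k)"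

definition Lambda :: "complex set" where
  "Lambda = {1 / of_nat (n + 1) | n :: nat. True}"

end

theory Submission
  imports Defs
begin

text \<open>
  The means \<open>v\<close> of a sequence \<open>a\<close> satisfy \<open>(n + 1) v\<^sub>n = t n v\<^sub>n\<^sub>-\<^sub>1 + a\<^sub>n\<close>, a first-order recursion whose
  ratio \<open>t n / (n + 1)\<close> stays below \<open>t < 1\<close>. Everything about the operator is read off from it.

  Norm bound. If \<open>a\<close> is nonnegative and decreasing, then so is \<open>v\<close> (\<open>cesaro_real_decseq\<close>). Hence the means
  of the least decreasing majorant of \<open>x\<close> form a decreasing majorant of the means of \<open>x\<close>, and estimates in \<open>d\<^sub>p\<close> reduce to estimates in \<open>\<ell>\<^sup>p\<close>. There, \<open>v\<^sub>n \<le> t v\<^sub>n\<^sub>-\<^sub>1 + (1 - t) (a\<^sub>n / (1 - t))\<close> is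
  a convex combination, and convexity of the \<open>p\<close>-th power yields the bound \<open>1 / (1 - t)\<close> for the operator
  norm, which is below \<open>(1 - t) powr (- 1 - 1 / p)\<close>.

  Compactness. A decreasing sequence in the unit ball of \<open>\<ell>\<^sup>p\<close> is at most \<open>(n + 1) powr (- 1 / p)\<close>. The means
  gain a further factor \<open>1 / (n + 1)\<close> (\<open>cesaro_decay\<close>), so the image of the unit ball lies in an order interval
  \<open>{y. \<bar>y\<bar> \<le> w}\<close> with \<open>w\<close> decreasing and in \<open>\<ell>\<^sup>p\<close>. Such an interval is compact in \<open>d\<^sub>p\<close>
  (\<open>compactin_order_interval\<close>): it is compact for pointwise convergence by Tychonoff's theorem, and on it
  pointwise convergence implies convergence in norm by dominated convergence.

  Spectrum. The operator is lower triangular with diagonal \<open>1 / (n + 1)\<close>, so the shifted operator is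
  injective when \<open>\<mu>\<close> is not in \<open>\<Lambda>\<close>. For \<open>\<mu> = 1 / (m + 1)\<close> the sequence \<open>(n choose m) t\<^sup>n\<^sup>-\<^sup>m\<close> is an
  eigenvector (\<open>cesaro_eigenvector\<close>); it lies in \<open>d\<^sub>p\<close> because it decays geometrically. For \<open>\<mu>\<close> outside
  \<open>\<Lambda> \<union> {0}\<close> the equation \<open>C\<^sub>t x - \<mu> x = y\<close> is solved through \<open>u = C\<^sub>t x\<close>, which obeys a first-order recursion
  whose ratio tends to \<open>t\<close>. So \<open>u\<close> is dominated by a multiple of the means of the majorant of \<open>y\<close> for any
  \<open>q\<close> with \<open>t < q < 1\<close> (\<open>resolvent_mean_bound\<close>), and the inverse is continuous by the norm bound for \<open>q\<close>.
  For \<open>\<mu> = 0\<close> the range is dense since it contains every finitely supported sequence, but it is not all of \<open>d\<^sub>p\<close>,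
  because its elements decay faster than general elements of \<open>d\<^sub>p\<close>.
\<close>

section \<open>The sequence spaces\<close>

abbreviation hat :: "cseq \<Rightarrow> nat \<Rightarrow> real" where
  "hat \<equiv> least_decreasing_majorant"

text \<open>
  The fact \<open>powr_convex\<close> concerns positive arguments; the value \<open>0\<close> is added here since it
  occurs among the terms of the sequences.
\<close>

lemma powr_convex_combination:
  fixes a b s p :: real
  assumes "1 \<le> p" "0 \<le> a" "0 \<le> b" "0 \<le> s" "s \<le> 1"
  shows "(s * a + (1 - s) * b) powr p \<le> s * a powr p + (1 - s) * b powr p"
proof -
  have shrink: "(r * c) powr p \<le> r * c powr p" if "0 \<le> r" "r \<le> 1" "0 \<le> c" for r c :: real
  proof -
    have "r powr p \<le> r powr 1"
      using that assms(1) by (intro powr_mono') auto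
    then show ?thesis
      using that by (simp add: powr_mult mult_right_mono)
  qed
  consider "a = 0" | "b = 0" | "0 < a" "0 < b"
    using assms by linarith
  then show ?thesis
  proof cases
    case 1
    then show ?thesis using shrink[of "1 - s" b] assms by simp
  next
    case 2
    then show ?thesis using shrink[of s a] assms by simp
  next
    case 3
    then show ?thesis
      using convex_onD[OF powr_convex[OF assms(1)], of s b a] assms
      by (simp add: algebra_simps)
  qed
qed

lemma lp_norm_nonneg: "0 \<le> lp_norm p x"
  by (simp add: lp_norm_def)

lemma lp_norm_powr:
  assumes "1 \<le> p" "x \<in> lp_space p"
  shows "lp_norm p x powr p = (\<Sum>n. norm (x n) powr p)"
proof -
  have "0 \<le> (\<Sum>n. norm (x n) powr p)"
    using assms(2) unfolding lp_space_def by (intro suminf_nonneg) auto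
  then show ?thesis
    using assms(1) by (simp add: lp_norm_def powr_powr)
qed

lemma lp_norm_le_iff:
  assumes "1 \<le> p" "x \<in> lp_space p" "0 \<le> A"
  shows "lp_norm p x \<le> A \<longleftrightarrow> (\<Sum>n. norm (x n) powr p) \<le> A powr p"
  unfolding lp_norm_powr[OF assms(1,2), symmetric]
proof
  assume "lp_norm p x \<le> A"
  then show "lp_norm p x powr p \<le> A powr p"
    using assms(1) lp_norm_nonneg[of p x] by (intro powr_mono2) auto
next
  assume le: "lp_norm p x powr p \<le> A powr p"
  show "lp_norm p x \<le> A"
  proof (rule ccontr)
    assume "\<not> lp_norm p x \<le> A"
    then have "A powr p < lp_norm p x powr p"
      using assms by (intro powr_less_mono2) auto
    then show False using le by linarith
  qed
qed

lemma lp_dominated: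
  assumes "1 \<le> p" "y \<in> lp_space p" "\<And>n. norm (x n) \<le> norm (y n)"
  shows "x \<in> lp_space p" and "lp_norm p x \<le> lp_norm p y"
proof -
  have le: "norm (x n) powr p \<le> norm (y n) powr p" for n
    using assms(1,3) by (intro powr_mono2) auto
  have y: "summable (\<lambda>n. norm (y n) powr p)"
    using assms(2) by (simp add: lp_space_def)
  have x: "summable (\<lambda>n. norm (x n) powr p)"
    by (rule summable_comparison_test'[OF y, of 0]) (use le in auto)
  then show "x \<in> lp_space p" by (simp add: lp_space_def)
  have "(\<Sum>n. norm (x n) powr p) \<le> (\<Sum>n. norm (y n) powr p)"
    by (rule suminf_le[OF le x y])
  moreover have "0 \<le> (\<Sum>n. norm (x n) powr p)"
    using x by (intro suminf_nonneg) auto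
  ultimately show "lp_norm p x \<le> lp_norm p y"
    unfolding lp_norm_def using assms(1) by (intro powr_mono2) auto
qed

text \<open>
  Minkowski's inequality. For \<open>A\<close> and \<open>B\<close> positive and at least the two norms, divide by \<open>A + B\<close> and use
  convexity with weights \<open>A / (A + B)\<close> and \<open>B / (A + B)\<close>. Allowing \<open>A\<close> and \<open>B\<close> to exceed the norms avoids
  dividing by a vanishing norm; they decrease to the norms at the end.
\<close>

lemma lp_minkowski:
  assumes p: "1 \<le> p" and x: "x \<in> lp_space p" and y: "y \<in> lp_space p"
  shows "(\<lambda>n. x n + y n) \<in> lp_space p"
    and "lp_norm p (\<lambda>n. x n + y n) \<le> lp_norm p x + lp_norm p y"
proof -
  define f where "f = (\<lambda>n. norm (x n) powr p)"
  define g where "g = (\<lambda>n. norm (y n) powr p)"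
  have sum: "summable f" "summable g"
    using x y by (auto simp: lp_space_def f_def g_def)
  have main: "(\<lambda>n. x n + y n) \<in> lp_space p \<and> lp_norm p (\<lambda>n. x n + y n) \<le> A + B"
    if A: "0 < A" "lp_norm p x \<le> A" and B: "0 < B" "lp_norm p y \<le> B" for A B
  proof -
    define s where "s = A / (A + B)"
    have s: "0 \<le> s" "s \<le> 1" "1 - s = B / (A + B)"
      using A B by (auto simp: s_def field_simps)
    define h where "h = (\<lambda>n. (A + B) powr p * (s * (f n / A powr p) + (1 - s) * (g n / B powr p)))"
    have le: "norm (x n + y n) powr p \<le> h n" for n
    proof -
      have "norm (x n + y n) \<le> norm (x n) + norm (y n)"
        by (rule norm_triangle_ineq)
      also have "\<dots> = (A + B) * (s * (norm (x n) / A) + (1 - s) * (norm (y n) / B))"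
      proof -
        have "(A + B) * s = A" "(A + B) * (1 - s) = B"
          using A B unfolding s(3) by (auto simp: s_def)
        then show ?thesis
          using A B by (simp only: distrib_left mult.assoc[symmetric]) simp
      qed
      finally have "norm (x n + y n) powr p
          \<le> ((A + B) * (s * (norm (x n) / A) + (1 - s) * (norm (y n) / B))) powr p"
        using p by (intro powr_mono2) auto
      also have "\<dots> = (A + B) powr p * (s * (norm (x n) / A) + (1 - s) * (norm (y n) / B)) powr p"
        by (rule powr_mult)
      also have "\<dots> \<le> h n"
        unfolding h_def
        using powr_convex_combination[OF p _ _ s(1,2), of "norm (x n) / A" "norm (y n) / B"] A B
        by (intro mult_left_mono) (auto simp: powr_divide f_def g_def)
      finally show ?thesis .
    qed
    have h: "summable h" "suminf h
        = (A + B) powr p * (s * (suminf f / A powr p) + (1 - s) * (suminf g / B powr p))"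
    proof -
      have "h sums ((A + B) powr p * (s * (suminf f / A powr p) + (1 - s) * (suminf g / B powr p)))"
        unfolding h_def
        by (intro sums_mult sums_add sums_divide summable_sums sum)
      then show "summable h" "suminf h
        = (A + B) powr p * (s * (suminf f / A powr p) + (1 - s) * (suminf g / B powr p))"
        by (auto simp: sums_iff)
    qed
    have xy: "summable (\<lambda>n. norm (x n + y n) powr p)"
      by (rule summable_comparison_test'[OF h(1), of 0]) (use le in auto)
    then have mem: "(\<lambda>n. x n + y n) \<in> lp_space p"
      by (simp add: lp_space_def)
    have "(\<Sum>n. norm (x n + y n) powr p) \<le> suminf h"
      by (rule suminf_le[OF le xy h(1)])
    also have "\<dots> \<le> (A + B) powr p * (s * 1 + (1 - s) * 1)"
    proof -
      have "suminf f \<le> A powr p" "suminf g \<le> B powr p"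
        using lp_norm_le_iff[OF p x, of A] lp_norm_le_iff[OF p y, of B] A B
        by (auto simp: f_def g_def)
      then show ?thesis
        unfolding h(2) using A B s by (intro mult_left_mono add_mono) auto
    qed
    finally show ?thesis
      using mem lp_norm_le_iff[OF p mem, of "A + B"] A B by simp
  qed
  show "(\<lambda>n. x n + y n) \<in> lp_space p"
    using main[of "lp_norm p x + 1" "lp_norm p y + 1"] lp_norm_nonneg[of p x] lp_norm_nonneg[of p y]
    by simp
  show "lp_norm p (\<lambda>n. x n + y n) \<le> lp_norm p x + lp_norm p y"
  proof (rule field_le_epsilon)
    fix e :: real assume "0 < e"
    then show "lp_norm p (\<lambda>n. x n + y n) \<le> lp_norm p x + lp_norm p y + e"
      using main[of "lp_norm p x + e/2" "lp_norm p y + e/2"]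
        lp_norm_nonneg[of p x] lp_norm_nonneg[of p y]
      by simp
  qed
qed

lemma lp_scale:
  fixes a :: "nat \<Rightarrow> real"
  assumes "1 \<le> p" "a \<in> lp_space p"
  shows "(\<lambda>n. c * a n) \<in> lp_space p" and "lp_norm p (\<lambda>n. c * a n) = \<bar>c\<bar> * lp_norm p a"
proof -
  have a: "summable (\<lambda>n. norm (a n) powr p)"
    using assms(2) by (simp add: lp_space_def)
  have eq: "norm (c * a n) powr p = \<bar>c\<bar> powr p * norm (a n) powr p" for n
    by (simp add: abs_mult powr_mult)
  have "summable (\<lambda>n. norm (c * a n) powr p)"
    unfolding eq by (rule summable_mult[OF a])
  then show mem: "(\<lambda>n. c * a n) \<in> lp_space p"
    by (simp add: lp_space_def)
  have "(\<Sum>n. norm (c * a n) powr p) = \<bar>c\<bar> powr p * (\<Sum>n. norm (a n) powr p)"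
    unfolding eq by (rule suminf_mult[OF a])
  moreover have "0 \<le> (\<Sum>n. norm (a n) powr p)"
    using a by (intro suminf_nonneg) auto
  ultimately show "lp_norm p (\<lambda>n. c * a n) = \<bar>c\<bar> * lp_norm p a"
    using assms(1) by (simp add: lp_norm_def powr_mult powr_powr)
qed

lemma hat_upper:
  assumes "x \<in> linf_space" "n \<le> k"
  shows "norm (x k) \<le> hat x n"
proof -
  have "bdd_above ((\<lambda>k. norm (x k)) ` {n..})"
    using assms(1) unfolding linf_space_def bounded_iff by (auto simp: bdd_above_def)
  then show ?thesis
    unfolding least_decreasing_majorant_def using assms(2) by (intro cSUP_upper) auto
qed

lemma hat_least:
  assumes "\<And>k. n \<le> k \<Longrightarrow> norm (x k) \<le> c"
  shows "hat x n \<le> c"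
  unfolding least_decreasing_majorant_def using assms by (intro cSUP_least) auto

lemma hat_nonneg: "x \<in> linf_space \<Longrightarrow> 0 \<le> hat x n"
  using hat_upper[of x n n] norm_ge_zero[of "x n"] by linarith

lemma hat_decseq: "x \<in> linf_space \<Longrightarrow> decseq (hat x)"
  unfolding decseq_def by (auto intro!: hat_least intro: hat_upper)

lemma d_spaceD:
  assumes "x \<in> d_space p"
  shows "x \<in> linf_space" "hat x \<in> lp_space p" "\<And>n. 0 \<le> hat x n" "decseq (hat x)"
    "\<And>n. norm (x n) \<le> hat x n"
  using assms hat_nonneg hat_decseq hat_upper by (auto simp: d_space_def)

lemma d_norm_nonneg: "0 \<le> d_norm p x"
  by (simp add: d_norm_def lp_norm_nonneg)

text \<open>
  Every estimate in \<open>d\<^sub>p\<close> below comes from this: any decreasing majorant is above the least one, so an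
  \<open>\<ell>\<^sup>p\<close> bound for a decreasing majorant is a \<open>d\<^sub>p\<close> bound.
\<close>

lemma d_space_dominated:
  assumes p: "1 \<le> p" and w: "decseq w" "w \<in> lp_space p" and le: "\<And>n. norm (x n) \<le> w n"
  shows "x \<in> d_space p" and "\<And>n. hat x n \<le> w n" and "d_norm p x \<le> lp_norm p w"
proof -
  have le': "norm (x k) \<le> w n" if "n \<le> k" for n k
    using le[of k] decseqD[OF w(1) that] by linarith
  then have inf: "x \<in> linf_space"
    unfolding linf_space_def bounded_iff by auto
  show hat: "hat x n \<le> w n" for n
    by (rule hat_least) (rule le')
  have dom: "norm (hat x n) \<le> norm (w n)" for n
    using hat[of n] hat_nonneg[OF inf, of n] by simp
  show "x \<in> d_space p" "d_norm p x \<le> lp_norm p w"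
    using lp_dominated[OF p w(2), of "hat x"] dom inf by (auto simp: d_space_def d_norm_def)
qed

lemma d_space_add:
  assumes p: "1 \<le> p" and x: "x \<in> d_space p" and y: "y \<in> d_space p"
  shows "(\<lambda>n. x n + y n) \<in> d_space p"
    and "d_norm p (\<lambda>n. x n + y n) \<le> d_norm p x + d_norm p y"
proof -
  note x' = d_spaceD[OF x] and y' = d_spaceD[OF y]
  have dec: "decseq (\<lambda>n. hat x n + hat y n)"
    using x'(4) y'(4) by (auto simp: decseq_def intro: add_mono)
  have le: "norm (x n + y n) \<le> hat x n + hat y n" for n
    using norm_triangle_ineq[of "x n" "y n"] x'(5)[of n] y'(5)[of n] by linarith
  note dom = d_space_dominated[OF p dec lp_minkowski(1)[OF p x'(2) y'(2)] le]
  show "(\<lambda>n. x n + y n) \<in> d_space p" by (rule dom(1))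
  show "d_norm p (\<lambda>n. x n + y n) \<le> d_norm p x + d_norm p y"
    using dom(3) lp_minkowski(2)[OF p x'(2) y'(2)] by (simp add: d_norm_def)
qed

lemma d_space_scale:
  assumes p: "1 \<le> p" and x: "x \<in> d_space p"
  shows "(\<lambda>n. c * x n) \<in> d_space p" and "d_norm p (\<lambda>n. c * x n) \<le> norm c * d_norm p x"
proof -
  note x' = d_spaceD[OF x]
  have dec: "decseq (\<lambda>n. norm c * hat x n)"
    using x'(4) by (auto simp: decseq_def intro: mult_left_mono)
  have le: "norm (c * x n) \<le> norm c * hat x n" for n
    using x'(5)[of n] by (simp add: norm_mult mult_left_mono)
  note dom = d_space_dominated[OF p dec lp_scale(1)[OF p x'(2)] le]
  show "(\<lambda>n. c * x n) \<in> d_space p" by (rule dom(1))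
  show "d_norm p (\<lambda>n. c * x n) \<le> norm c * d_norm p x"
    using dom(3) lp_scale(2)[OF p x'(2), of "norm c"] by (simp add: d_norm_def)
qed

lemma d_space_diff:
  assumes p: "1 \<le> p" and x: "x \<in> d_space p" and y: "y \<in> d_space p"
  shows "(\<lambda>n. x n - y n) \<in> d_space p"
    and "d_norm p (\<lambda>n. x n - y n) \<le> d_norm p x + d_norm p y"
  using d_space_add[OF p x d_space_scale(1)[OF p y, of "-1"]] d_space_scale(2)[OF p y, of "-1"]
  by auto

text \<open>
  The first \<open>n + 1\<close> terms of the decreasing majorant are all at least \<open>hat x n\<close>, so
  \<open>(n + 1) (hat x n)\<^sup>p\<close> is at most the \<open>p\<close>-th power of the norm.
\<close>

lemma hat_le_d_norm:
  assumes p: "1 \<le> p" and x: "x \<in> d_space p"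
  shows "hat x n \<le> d_norm p x * real (n + 1) powr (- 1 / p)"
proof -
  note x' = d_spaceD[OF x]
  have s: "summable (\<lambda>n. norm (hat x n) powr p)"
    using x'(2) by (simp add: lp_space_def)
  have "real (n + 1) * hat x n powr p = (\<Sum>k<n+1. hat x n powr p)"
    by simp
  also have "\<dots> \<le> (\<Sum>k<n+1. norm (hat x k) powr p)"
    using p x'(3) decseqD[OF x'(4)] by (intro sum_mono powr_mono2) auto
  also have "\<dots> \<le> (\<Sum>k. norm (hat x k) powr p)"
    by (intro sum_le_suminf s) auto
  also have "\<dots> = d_norm p x powr p"
    unfolding d_norm_def by (rule lp_norm_powr[OF p x'(2), symmetric])
  finally have "(real (n + 1) * hat x n powr p) powr (1 / p) \<le> (d_norm p x powr p) powr (1 / p)"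
    using p by (intro powr_mono2) auto
  then have "real (n + 1) powr (1 / p) * hat x n \<le> d_norm p x"
    using p x'(3)[of n] d_norm_nonneg[of p x] by (simp add: powr_mult powr_powr)
  then show ?thesis
    by (simp add: powr_minus field_simps)
qed

lemma d_norm_eq_0:
  assumes "1 \<le> p" "x \<in> d_space p" "d_norm p x = 0"
  shows "x n = 0"
proof -
  have "norm (x n) \<le> 0"
    using hat_le_d_norm[OF assms(1,2), of n] d_spaceD(5)[OF assms(2), of n] unfolding assms(3)
    by linarith
  then show ?thesis by simp
qed

lemma hat_0: "hat (\<lambda>n. 0) = (\<lambda>n. 0)"
  by (simp add: least_decreasing_majorant_def fun_eq_iff)

lemma d_norm_0: "d_norm p (\<lambda>n. 0) = 0"
  by (simp add: d_norm_def hat_0 lp_norm_def)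

lemma d_norm_minus_commute: "d_norm p (\<lambda>n. x n - y n) = d_norm p (\<lambda>n. y n - x n)"
proof -
  have "hat (\<lambda>n. x n - y n) = hat (\<lambda>n. y n - x n)"
    unfolding least_decreasing_majorant_def by (subst norm_minus_commute) (rule refl)
  then show ?thesis by (simp add: d_norm_def)
qed

lemma d_space_Metric_space:
  assumes p: "1 \<le> p"
  shows "Metric_space (d_space p) (\<lambda>x y. d_norm p (\<lambda>n. x n - y n))"
proof
  show "0 \<le> d_norm p (\<lambda>n. x n - y n)" for x y by (rule d_norm_nonneg)
  show "d_norm p (\<lambda>n. x n - y n) = d_norm p (\<lambda>n. y n - x n)" for x y
    by (rule d_norm_minus_commute)
  show "(d_norm p (\<lambda>n. x n - y n) = 0) = (x = y)" if "x \<in> d_space p" "y \<in> d_space p" for x y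
    using d_norm_eq_0[OF p d_space_diff(1)[OF p that]] by (auto simp: d_norm_0)
  show "d_norm p (\<lambda>n. x n - z n) \<le> d_norm p (\<lambda>n. x n - y n) + d_norm p (\<lambda>n. y n - z n)"
    if "x \<in> d_space p" "y \<in> d_space p" "z \<in> d_space p" for x y z
    using d_space_add(2)[OF p d_space_diff(1)[OF p that(1,2)] d_space_diff(1)[OF p that(2,3)]]
    by simp
qed

lemma lp_tendsto_0:
  fixes w :: "nat \<Rightarrow> real"
  assumes p: "1 \<le> p" and w: "w \<in> lp_space p"
  shows "w \<longlonglongrightarrow> 0"
proof -
  have "(\<lambda>n. norm (w n) powr p) \<longlonglongrightarrow> 0"
    using w by (auto simp: lp_space_def intro: summable_LIMSEQ_zero)
  then have "(\<lambda>n. (norm (w n) powr p) powr (1 / p)) \<longlonglongrightarrow> 0 powr (1 / p)"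
    using p by (intro tendsto_powr2) auto
  then show ?thesis
    using p by (simp add: powr_powr tendsto_rabs_zero_iff)
qed

text \<open>
  The supremum over \<open>k \<ge> n\<close> splits into finitely many terms, which tend to \<open>0\<close> one by one, and a tail on
  which \<open>w\<close> is small. So the majorants tend to \<open>0\<close> pointwise, and Tannery's theorem applies to their
  \<open>p\<close>-th powers.
\<close>

lemma d_norm_dominated_convergence:
  assumes p: "1 \<le> p" and w: "decseq w" "w \<in> lp_space p"
    and le: "\<And>j n. norm (y j n) \<le> w n" and lim: "\<And>n. (\<lambda>j. y j n) \<longlonglongrightarrow> 0"
  shows "(\<lambda>j. d_norm p (y j)) \<longlonglongrightarrow> 0"
proof -
  note dom = d_space_dominated[OF p w, of "y _", OF le]
  note y = d_spaceD[OF dom(1)]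
  have w0: "w \<longlonglongrightarrow> 0" by (rule lp_tendsto_0[OF p w(2)])
  have hat_lim: "(\<lambda>j. hat (y j) n) \<longlonglongrightarrow> 0" for n
  proof (rule LIMSEQ_I)
    fix e :: real assume e: "0 < e"
    obtain m where m: "w m < e / 2"
      using order_tendstoD(2)[OF w0, of "e/2"] e by (auto simp: eventually_sequentially)
    have "\<forall>\<^sub>F j in sequentially. \<forall>k\<in>{..<m}. norm (y j k) < e / 2"
    proof (intro eventually_ball_finite ballI)
      fix k show "\<forall>\<^sub>F j in sequentially. norm (y j k) < e / 2"
        using order_tendstoD(2)[OF tendsto_norm_zero[OF lim[of k]], of "e/2"] e by simp
    qed simp
    then obtain J where J: "\<And>j k. J \<le> j \<Longrightarrow> k < m \<Longrightarrow> norm (y j k) < e / 2"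
      by (auto simp: eventually_sequentially)
    have "hat (y j) n \<le> e / 2" if "J \<le> j" for j
    proof (rule hat_least)
      fix k show "norm (y j k) \<le> e / 2"
        using J[OF that, of k] le[of j k] decseqD[OF w(1), of m k] m
        by (cases "k < m") auto
    qed
    then show "\<exists>J. \<forall>j\<ge>J. norm (hat (y j) n - 0) < e"
      using y(3) e by (intro exI[of _ J]) force
  qed
  have "((\<lambda>j. \<Sum>n. norm (hat (y j) n) powr p) \<longlongrightarrow> (\<Sum>n. 0 powr p)) sequentially"
  proof (rule conjunct2[OF conjunct2[OF tannerys_theorem]])
    show "((\<lambda>j. norm (hat (y j) n) powr p) \<longlongrightarrow> 0 powr p) sequentially" for n
      using p tendsto_norm_zero[OF hat_lim[of n]] by (intro tendsto_powr2) auto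
    show "\<forall>\<^sub>F (n, j) in sequentially \<times>\<^sub>F sequentially. norm (norm (hat (y j) n) powr p) \<le> norm (w n) powr p"
    proof (intro always_eventually allI, clarify)
      fix n j show "norm (norm (hat (y j) n) powr p) \<le> norm (w n) powr p"
        using p dom(2)[of j n] y(3)[of j n] by (simp add: powr_mono2)
    qed
    show "summable (\<lambda>n. norm (w n) powr p)"
      using w(2) by (simp add: lp_space_def)
  qed simp
  then have "(\<lambda>j. (\<Sum>n. norm (hat (y j) n) powr p) powr (1 / p)) \<longlonglongrightarrow> 0 powr (1 / p)"
    using p y(2) by (intro tendsto_powr2) (auto intro!: always_eventually suminf_nonneg simp: lp_space_def)
  then show ?thesis
    by (simp add: d_norm_def lp_norm_def)
qed

section \<open>Continuity, compactness and density in the spaces\<close>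

lemma d_bounded_operator:
  assumes p: "1 \<le> p"
    and maps: "\<And>x. x \<in> d_space p \<Longrightarrow> T x \<in> d_space p"
    and add: "\<And>x y. T (\<lambda>n. x n + y n) = (\<lambda>n. T x n + T y n)"
    and scale: "\<And>c x. T (\<lambda>n. c * x n) = (\<lambda>n. c * T x n)"
    and bound: "\<And>x. x \<in> d_space p \<Longrightarrow> d_norm p (T x) \<le> K * d_norm p x"
  shows "T \<in> continuous_linear_operators (d_space p) (d_norm p)"
proof -
  interpret d: Metric_space "d_space p" "\<lambda>x y. d_norm p (\<lambda>n. x n - y n)"
    by (rule d_space_Metric_space[OF p])
  have diff: "T (\<lambda>n. x n - y n) = (\<lambda>n. T x n - T y n)" for x y
    using add[of x "\<lambda>n. -1 * y n"] scale[of "-1" y] by simp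
  have "continuous_map d.mtopology d.mtopology T"
    unfolding d.metric_continuous_map[OF d.Metric_space_axioms]
  proof (intro conjI ballI allI impI)
    show "T ` d_space p \<subseteq> d_space p" using maps by blast
    fix a and e :: real assume a: "a \<in> d_space p" and e: "0 < e"
    define L where "L = max K 1"
    have L: "0 < L" "K \<le> L" by (auto simp: L_def)
    show "\<exists>\<delta>>0. \<forall>x. x \<in> d_space p \<and> d_norm p (\<lambda>n. a n - x n) < \<delta>
        \<longrightarrow> d_norm p (\<lambda>n. T a n - T x n) < e"
    proof (intro exI[of _ "e / L"] conjI allI impI)
      show "0 < e / L" using e L by simp
      fix x assume x: "x \<in> d_space p \<and> d_norm p (\<lambda>n. a n - x n) < e / L"
      have "d_norm p (\<lambda>n. T a n - T x n) \<le> K * d_norm p (\<lambda>n. a n - x n)"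
        using bound[OF d_space_diff(1)[OF p a conjunct1[OF x]]] by (simp add: diff)
      also have "\<dots> \<le> L * d_norm p (\<lambda>n. a n - x n)"
        using L by (intro mult_right_mono d_norm_nonneg)
      also have "\<dots> < e"
        using x L by (simp add: field_simps)
      finally show "d_norm p (\<lambda>n. T a n - T x n) < e" .
    qed
  qed
  then show ?thesis
    unfolding continuous_linear_operators_def norm_topology_def mem_Collect_eq
    by (intro conjI ballI allI image_subsetI maps add scale)
qed

text \<open>
  On an order interval the norm topology is no finer than the compact product topology, because pointwise
  convergence there is dominated by \<open>2 w\<close>.
\<close>

lemma compactin_order_interval:
  assumes p: "1 \<le> p" and w: "decseq w" "w \<in> lp_space p"
  shows "compactin (norm_topology (d_space p) (d_norm p)) {x. \<forall>n. norm (x n) \<le> w n}"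
proof -
  interpret d: Metric_space "d_space p" "\<lambda>x y. d_norm p (\<lambda>n. x n - y n)"
    by (rule d_space_Metric_space[OF p])
  let ?K = "{x :: cseq. \<forall>n. norm (x n) \<le> w n}"
  have K_d: "x \<in> d_space p" if "x \<in> ?K" for x
    using d_space_dominated(1)[OF p w] that by blast
  have "compactin (product_topology (\<lambda>i::nat. euclidean :: complex topology) UNIV)
      (Pi\<^sub>E UNIV (\<lambda>n. cball 0 (w n)))"
    by (subst compactin_PiE) (auto simp: compact_cball)
  moreover have "Pi\<^sub>E UNIV (\<lambda>n. cball 0 (w n)) = ?K"
    by (auto simp: PiE_iff)
  ultimately have "compact ?K"
    by (simp add: euclidean_product_topology)
  then have seq: "seq_compact ?K"
    by (rule compact_imp_seq_compact)
  have "compactin d.mtopology ?K"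
    unfolding d.compactin_sequentially
  proof (intro conjI allI impI)
    show "?K \<subseteq> d_space p" using K_d by blast
    fix \<sigma> :: "nat \<Rightarrow> cseq" assume ran: "range \<sigma> \<subseteq> ?K"
    then have "\<forall>j. \<sigma> j \<in> ?K" by blast
    from seq_compactE[OF seq this]
    obtain l r where l: "l \<in> ?K" and r: "strict_mono r" and lim: "(\<sigma> \<circ> r) \<longlonglongrightarrow> l"
      by blast
    have lim_n: "(\<lambda>j. (\<sigma> \<circ> r) j n - l n) \<longlonglongrightarrow> 0" for n
    proof -
      have "continuous_on UNIV (\<lambda>f :: cseq. f n)"
        by (rule continuous_on_product_coordinates)
      then have "isCont (\<lambda>f :: cseq. f n) l"
        using continuous_on_eq_continuous_at[OF open_UNIV] by blast
      from isCont_tendsto_compose[OF this lim] show ?thesis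
        by (simp add: LIM_zero)
    qed
    have dec2: "decseq (\<lambda>n. 2 * w n)"
      using w(1) by (auto simp: decseq_def)
    have bound2: "norm ((\<sigma> \<circ> r) j n - l n) \<le> 2 * w n" for j n
    proof -
      have "norm ((\<sigma> \<circ> r) j n) \<le> w n" "norm (l n) \<le> w n"
        using ran l by auto
      then show ?thesis
        using norm_triangle_ineq4[of "(\<sigma> \<circ> r) j n" "l n"] by linarith
    qed
    have "(\<lambda>j. d_norm p (\<lambda>n. (\<sigma> \<circ> r) j n - l n)) \<longlonglongrightarrow> 0"
      by (rule d_norm_dominated_convergence[OF p dec2 lp_scale(1)[OF p w(2)] bound2 lim_n])
    moreover have "(\<sigma> \<circ> r) j \<in> d_space p" for j
      using K_d ran by auto
    ultimately have "limitin d.mtopology (\<sigma> \<circ> r) l sequentially"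
      unfolding d.limitin_metric_dist_null using K_d[OF l] by (auto intro: always_eventually)
    then show "\<exists>l r. l \<in> ?K \<and> strict_mono r \<and> limitin d.mtopology (\<sigma> \<circ> r) l sequentially"
      using l r by blast
  qed
  then show ?thesis by (simp add: norm_topology_def)
qed

lemma d_space_finite_support:
  assumes p: "1 \<le> p" and x: "\<And>n. m \<le> n \<Longrightarrow> x n = 0"
  shows "x \<in> d_space p"
proof (rule d_space_dominated(1)[OF p])
  define w where "w = (\<lambda>n. if n < m then \<Sum>k<m. norm (x k) else 0)"
  show "decseq w"
    by (auto simp: decseq_def w_def intro: sum_nonneg)
  show "w \<in> lp_space p"
    unfolding lp_space_def using p
    by (auto intro!: summable_finite[of "{..<m}"] simp: w_def split: if_splits)
  show "norm (x n) \<le> w n" for n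
    using x[of n] member_le_sum[of n "{..<m}" "\<lambda>k. norm (x k)"] by (auto simp: w_def)
qed

text \<open>
  Truncations of \<open>x\<close> converge to \<open>x\<close> in norm: the remainders are dominated by the majorant of \<open>x\<close>
  and vanish pointwise in the limit.
\<close>

lemma d_closure_finite_support:
  assumes p: "1 \<le> p" and S: "S \<subseteq> d_space p"
    and finite: "\<And>x m. (\<And>n. m \<le> n \<Longrightarrow> x n = 0) \<Longrightarrow> x \<in> S"
  shows "norm_topology (d_space p) (d_norm p) closure_of S = d_space p"
proof -
  interpret d: Metric_space "d_space p" "\<lambda>x y. d_norm p (\<lambda>n. x n - y n)"
    by (rule d_space_Metric_space[OF p])
  have "\<exists>y\<in>S. y \<in> d.mball x e" if x: "x \<in> d_space p" and e: "0 < e" for x e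
  proof -
    define trunc where "trunc = (\<lambda>j n. if n < j then x n else 0)"
    have "(\<lambda>j. d_norm p (\<lambda>n. x n - trunc j n)) \<longlonglongrightarrow> 0"
    proof (rule d_norm_dominated_convergence[OF p d_spaceD(4,2)[OF x]])
      show "norm (x n - trunc j n) \<le> hat x n" for j n
        using d_spaceD(3,5)[OF x] by (simp add: trunc_def)
      show "(\<lambda>j. x n - trunc j n) \<longlonglongrightarrow> 0" for n
        by (rule tendsto_eventually)
          (auto simp: trunc_def eventually_sequentially intro!: exI[of _ "Suc n"])
    qed
    from order_tendstoD(2)[OF this e] obtain j where "d_norm p (\<lambda>n. x n - trunc j n) < e"
      by (auto simp: eventually_sequentially)
    moreover have "trunc j \<in> S"
      by (rule finite[of j]) (simp add: trunc_def)
    ultimately show ?thesis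
      using x S by (intro bexI[of _ "trunc j"]) auto
  qed
  then show ?thesis
    unfolding norm_topology_def d.metric_closure_of by blast
qed

section \<open>Means of decreasing real sequences\<close>

text \<open>
  The sequence of generalized means of a real sequence, given by the recursion
  \<open>(n + 1) v\<^sub>n = t n v\<^sub>n\<^sub>-\<^sub>1 + a\<^sub>n\<close> instead of the sum, since all estimates on it are proved along this recursion.
\<close>

primrec cesaro_real :: "real \<Rightarrow> (nat \<Rightarrow> real) \<Rightarrow> nat \<Rightarrow> real" where
  "cesaro_real t a 0 = a 0"
| "cesaro_real t a (Suc n) = (t * real (n + 1) * cesaro_real t a n + a (Suc n)) / real (n + 2)"

lemma cesaro_real_nonneg:
  assumes "0 \<le> t" "\<And>n. 0 \<le> a n"
  shows "0 \<le> cesaro_real t a n"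
  using assms by (induction n) auto

text \<open>
  By the recursion, \<open>v\<^sub>n\<^sub>+\<^sub>1 \<le> v\<^sub>n\<close> amounts to \<open>a\<^sub>n\<^sub>+\<^sub>1 \<le> ((1 - t) (n + 1) + 1) v\<^sub>n\<close>. Since \<open>a\<close> decreases, the same
  inequality with \<open>a\<^sub>n\<close> on the left suffices, and that form carries over from \<open>n\<close> to \<open>n + 1\<close>.
\<close>

lemma cesaro_real_decseq:
  assumes t: "0 \<le> t" "t < 1" and a: "decseq a" "\<And>n. 0 \<le> a n"
  shows "decseq (cesaro_real t a)"
proof (rule decseq_SucI)
  let ?v = "cesaro_real t a"
  have key: "a n \<le> ((1 - t) * real (n + 1) + 1) * ?v n" for n
  proof (induction n)
    case 0
    have "1 * a 0 \<le> ((1 - t) * real (0 + 1) + 1) * a 0"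
      using t a(2)[of 0] by (intro mult_right_mono) auto
    then show ?case by simp
  next
    case (Suc n)
    define c where "c = (1 - t) * real (n + 1) + 1"
    have c: "0 < c" "c \<le> (1 - t) * real (Suc n + 1) + 1"
      using t by (auto simp: c_def intro!: add_nonneg_pos mult_left_mono)
    have "a (Suc n) \<le> c * ?v n"
      using Suc.IH decseq_SucD[OF a(1), of n] by (simp add: c_def)
    then have "t * real (n + 1) * a (Suc n) \<le> t * real (n + 1) * (c * ?v n)"
      using t by (intro mult_left_mono) auto
    then have "a (Suc n) * (t * real (n + 1) + c) \<le> c * (t * real (n + 1) * ?v n + a (Suc n))"
      by (simp add: algebra_simps)
    moreover have "t * real (n + 1) + c = real (n + 2)"
      by (simp add: c_def algebra_simps)
    ultimately have "a (Suc n) * real (n + 2) \<le> c * (t * real (n + 1) * ?v n + a (Suc n))"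
      by simp
    then have "a (Suc n) \<le> c * ?v (Suc n)"
      by (simp add: pos_le_divide_eq)
    also have "\<dots> \<le> ((1 - t) * real (Suc n + 1) + 1) * ?v (Suc n)"
      using c(2) cesaro_real_nonneg[OF t(1) a(2)] by (rule mult_right_mono)
    finally show ?case .
  qed
  fix n
  have "t * real (n + 1) * ?v n + a (Suc n)
      \<le> t * real (n + 1) * ?v n + ((1 - t) * real (n + 1) + 1) * ?v n"
    using key[of n] decseq_SucD[OF a(1), of n] by linarith
  also have "\<dots> = ?v n * real (n + 2)"
    by (simp add: algebra_simps)
  finally show "?v (Suc n) \<le> ?v n"
    by (simp add: pos_divide_le_eq)
qed

text \<open>
  With \<open>b = a / (1 - t)\<close>, convexity gives \<open>v\<^sub>n\<^sup>p \<le> t v\<^sub>n\<^sub>-\<^sub>1\<^sup>p + (1 - t) b\<^sub>n\<^sup>p\<close>. Summing, the partial sums \<open>S\<close> of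
  the left-hand side satisfy \<open>S \<le> t S + (1 - t) \<Sum> b\<^sup>p\<close>, whence \<open>S \<le> \<Sum> b\<^sup>p\<close>.
\<close>

lemma cesaro_real_lp:
  assumes p: "1 \<le> p" and t: "0 \<le> t" "t < 1" and a: "\<And>n. 0 \<le> a n" "a \<in> lp_space p"
  shows "cesaro_real t a \<in> lp_space p"
    and "lp_norm p (cesaro_real t a) \<le> lp_norm p a / (1 - t)"
proof -
  let ?v = "cesaro_real t a"
  have v: "0 \<le> ?v n" for n
    using t(1) a(1) by (rule cesaro_real_nonneg)
  define b where "b = (\<lambda>n. 1 / (1 - t) * a n)"
  have b: "0 \<le> b n" for n using t a(1) by (simp add: b_def)
  have b_lp: "b \<in> lp_space p" "lp_norm p b = lp_norm p a / (1 - t)"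
    using lp_scale[OF p a(2), of "1 / (1 - t)"] t by (auto simp: b_def)
  have b_sum: "summable (\<lambda>n. norm (b n) powr p)"
    using b_lp(1) by (simp add: lp_space_def)
  have step: "(t * c + a n) powr p \<le> t * c powr p + (1 - t) * b n powr p" if "0 \<le> c" for c n
    using powr_convex_combination[OF p that b[of n] t(1)] t by (simp add: b_def)
  have partial: "(\<Sum>k<Suc n. ?v k powr p) \<le> t * (\<Sum>k<n. ?v k powr p) + (1 - t) * (\<Sum>k<Suc n. b k powr p)"
    for n
  proof (induction n)
    case 0
    show ?case using step[of 0 0] by simp
  next
    case (Suc n)
    have "t * real (n + 1) * ?v n + a (Suc n) \<le> (t * ?v n + a (Suc n)) * real (n + 2)"
      using t v[of n] a(1)[of "Suc n"] by (simp add: algebra_simps)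
    then have "?v (Suc n) \<le> t * ?v n + a (Suc n)"
      by (simp add: pos_divide_le_eq)
    then have "?v (Suc n) powr p \<le> (t * ?v n + a (Suc n)) powr p"
      using p v by (intro powr_mono2) (auto simp del: cesaro_real.simps)
    also note step[OF v]
    finally have "?v (Suc n) powr p \<le> t * ?v n powr p + (1 - t) * b (Suc n) powr p" .
    moreover have "(\<Sum>k<Suc (Suc n). ?v k powr p) = (\<Sum>k<Suc n. ?v k powr p) + ?v (Suc n) powr p"
      "(\<Sum>k<Suc (Suc n). b k powr p) = (\<Sum>k<Suc n. b k powr p) + b (Suc n) powr p"
      "(\<Sum>k<Suc n. ?v k powr p) = (\<Sum>k<n. ?v k powr p) + ?v n powr p"
      by (simp_all only: sum.lessThan_Suc)
    ultimately show ?case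
      using Suc.IH by (simp add: distrib_left del: sum.lessThan_Suc cesaro_real.simps)
  qed
  have bound: "(\<Sum>k<n. norm (?v k) powr p) \<le> lp_norm p b powr p" for n
  proof -
    let ?S = "\<Sum>k<n. ?v k powr p"
    have B: "(\<Sum>k<Suc n. b k powr p) \<le> lp_norm p b powr p"
      using sum_le_suminf[OF b_sum, of "{..<Suc n}"] b
      by (simp add: lp_norm_powr[OF p b_lp(1)] del: sum.lessThan_Suc)
    have "?S \<le> (\<Sum>k<Suc n. ?v k powr p)"
      by simp
    also note partial
    also have "t * ?S + (1 - t) * (\<Sum>k<Suc n. b k powr p) \<le> t * ?S + (1 - t) * lp_norm p b powr p"
      using B t by (intro add_left_mono mult_left_mono) auto
    finally have "(1 - t) * ?S \<le> (1 - t) * lp_norm p b powr p"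
      using t by (simp add: algebra_simps)
    then have "?S \<le> lp_norm p b powr p"
      using t by simp
    then show ?thesis using v by simp
  qed
  have sum: "summable (\<lambda>k. norm (?v k) powr p)"
    by (rule summableI_nonneg_bounded[OF _ bound]) simp
  then show mem: "?v \<in> lp_space p"
    by (simp add: lp_space_def)
  show "lp_norm p ?v \<le> lp_norm p a / (1 - t)"
    using suminf_le_const[OF sum bound] lp_norm_le_iff[OF p mem lp_norm_nonneg[of p b]]
    unfolding b_lp(2) by blast
qed

lemma d_space_cesaro_dominated:
  assumes p: "1 \<le> p" and t: "0 \<le> t" "t < 1" and x: "x \<in> d_space p" and C: "0 \<le> C"
    and le: "\<And>n. norm (u n) \<le> C * cesaro_real t (hat x) n"
  shows "u \<in> d_space p" and "d_norm p u \<le> C / (1 - t) * d_norm p x"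
proof -
  note x' = d_spaceD[OF x]
  note lp = cesaro_real_lp[OF p t x'(3,2)]
  have dec: "decseq (\<lambda>n. C * cesaro_real t (hat x) n)"
    using cesaro_real_decseq[OF t x'(4,3)] C by (auto simp: decseq_def intro: mult_left_mono)
  note dom = d_space_dominated[OF p dec lp_scale(1)[OF p lp(1)] le]
  show "u \<in> d_space p" by (rule dom(1))
  have "d_norm p u \<le> C * lp_norm p (cesaro_real t (hat x))"
    using dom(3) lp_scale(2)[OF p lp(1), of C] C by simp
  also have "\<dots> \<le> C * (lp_norm p (hat x) / (1 - t))"
    using lp(2) C by (rule mult_left_mono)
  finally show "d_norm p u \<le> C / (1 - t) * d_norm p x"
    by (simp add: d_norm_def)
qed

section \<open>Boundedness and compactness of the operator\<close>

lemma cesaro_0: "cesaro t x 0 = x 0"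
  by (simp add: cesaro_def)

lemma cesaro_Suc:
  "cesaro t x (Suc n) = (of_real t * of_nat (n + 1) * cesaro t x n + x (Suc n)) / of_nat (n + 2)"
proof -
  have "(\<Sum>k=0..Suc n. of_real t ^ (Suc n - k) * x k)
      = of_real t * (\<Sum>k=0..n. of_real t ^ (n - k) * x k) + x (Suc n)"
    by (simp add: sum_distrib_left Suc_diff_le mult.assoc)
  moreover have "of_nat (n + 1) * cesaro t x n = (\<Sum>k=0..n. of_real t ^ (n - k) * x k)"
    unfolding cesaro_def using of_nat_neq_0[of n, where 'a = complex]
    by (simp del: of_nat_Suc)
  ultimately show ?thesis
    by (simp add: cesaro_def mult.assoc del: of_nat_Suc of_nat_add)
qed

lemma cesaro_unique:
  assumes "u 0 = x 0"
    and "\<And>n. of_nat (n + 2) * u (Suc n) = of_real t * of_nat (n + 1) * u n + x (Suc n)"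
  shows "cesaro t x = u"
proof
  fix n show "cesaro t x n = u n"
  proof (induction n)
    case 0
    then show ?case using assms(1) by (simp add: cesaro_0)
  next
    case (Suc n)
    have "(of_nat (n + 2) :: complex) \<noteq> 0"
      by (metis Suc_eq_plus1 add_2_eq_Suc' of_nat_neq_0)
    then show ?case
      unfolding cesaro_Suc Suc.IH assms(2)[symmetric] by (rule nonzero_mult_div_cancel_left)
  qed
qed

lemma cesaro_add: "cesaro t (\<lambda>n. x n + y n) = (\<lambda>n. cesaro t x n + cesaro t y n)"
  by (auto simp: cesaro_def fun_eq_iff distrib_left sum.distrib add_divide_distrib)

lemma cesaro_scale: "cesaro t (\<lambda>n. c * x n) = (\<lambda>n. c * cesaro t x n)"
  by (auto simp: cesaro_def fun_eq_iff sum_distrib_left mult.left_commute)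

lemma norm_cesaro_le:
  assumes t: "0 \<le> t" and x: "\<And>n. norm (x n) \<le> a n"
  shows "norm (cesaro t x n) \<le> cesaro_real t a n"
proof (induction n)
  case 0
  then show ?case using x by (simp add: cesaro_0)
next
  case (Suc n)
  have "norm (cesaro t x (Suc n))
      = norm (of_real t * of_nat (n + 1) * cesaro t x n + x (Suc n)) / real (n + 2)"
    by (simp only: cesaro_Suc norm_divide norm_of_nat)
  also have "\<dots> \<le> (t * real (n + 1) * cesaro_real t a n + a (Suc n)) / real (n + 2)"
  proof (rule divide_right_mono)
    have "norm (of_real t * of_nat (n + 1) * cesaro t x n + x (Suc n))
        \<le> norm (of_real t * of_nat (n + 1) * cesaro t x n) + norm (x (Suc n))"
      by (rule norm_triangle_ineq)
    also have "norm (of_real t * of_nat (n + 1) * cesaro t x n)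
        = t * real (n + 1) * norm (cesaro t x n)"
      using t by (simp only: norm_mult norm_of_real norm_of_nat abs_of_nonneg)
    also have "\<dots> \<le> t * real (n + 1) * cesaro_real t a n"
      using Suc t by (intro mult_left_mono) auto
    finally show "norm (of_real t * of_nat (n + 1) * cesaro t x n + x (Suc n))
        \<le> t * real (n + 1) * cesaro_real t a n + a (Suc n)"
      using x[of "Suc n"] by linarith
  qed simp
  finally show ?case by simp
qed

lemma cesaro_d_space:
  assumes p: "1 \<le> p" and t: "0 \<le> t" "t < 1" and x: "x \<in> d_space p"
  shows "cesaro t x \<in> d_space p" and "d_norm p (cesaro t x) \<le> 1 / (1 - t) * d_norm p x"
proof -
  have "norm (cesaro t x n) \<le> 1 * cesaro_real t (hat x) n" for n
    using norm_cesaro_le[OF t(1) d_spaceD(5)[OF x]] by simp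
  from d_space_cesaro_dominated[OF p t x _ this]
  show "cesaro t x \<in> d_space p" "d_norm p (cesaro t x) \<le> 1 / (1 - t) * d_norm p x"
    by auto
qed

lemma cesaro_continuous:
  assumes p: "1 \<le> p" and t: "0 \<le> t" "t < 1"
  shows "cesaro t \<in> continuous_linear_operators (d_space p) (d_norm p)"
  using d_bounded_operator[OF p cesaro_d_space(1)[OF p t] cesaro_add cesaro_scale
      cesaro_d_space(2)[OF p t]] .

lemma cesaro_operator_norm:
  assumes p: "1 \<le> p" and t: "0 \<le> t" "t < 1"
  shows "operator_norm (d_space p) (d_norm p) (cesaro t) \<le> 1 / (1 - t)"
  unfolding operator_norm_def
proof (rule cSUP_least)
  have "(\<lambda>n. 0) \<in> d_space p"
    by (rule d_space_finite_support[OF p]) simp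
  then show "{x \<in> d_space p. d_norm p x \<le> 1} \<noteq> {}"
    using d_norm_0[of p] by force
next
  fix x assume x: "x \<in> {x \<in> d_space p. d_norm p x \<le> 1}"
  then have "d_norm p (cesaro t x) \<le> 1 / (1 - t) * d_norm p x"
    using cesaro_d_space(2)[OF p t] by blast
  also have "\<dots> \<le> 1 / (1 - t) * 1"
    using x t by (intro mult_left_mono) auto
  finally show "d_norm p (cesaro t x) \<le> 1 / (1 - t)" by simp
qed

text \<open>
  The terms \<open>x\<^sub>k\<close> are at most a multiple of \<open>(k + 1) powr (- 1 / p)\<close>. Because \<open>n + 1 \<le> (k + 1) (n - k + 1)\<close>, replacing \<open>k\<close> by
  \<open>n\<close> in this bound costs at most a factor \<open>n - k + 1\<close>, which the weights \<open>t\<^sup>n\<^sup>-\<^sup>k\<close> absorb: the sum of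
  \<open>(j + 1) t\<^sup>j\<close> is \<open>1 / (1 - t)\<^sup>2\<close>. The prefactor \<open>1 / (n + 1)\<close> of the mean remains as a gain.
\<close>

lemma cesaro_decay:
  assumes p: "1 \<le> p" and t: "0 \<le> t" "t < 1" and x: "x \<in> d_space p"
  shows "norm (cesaro t x n) \<le> d_norm p x / (1 - t)\<^sup>2 * real (n + 1) powr (- 1 - 1 / p)"
proof -
  define r where "r = 1 / p"
  have r: "0 \<le> r" "r \<le> 1" using p by (auto simp: r_def)
  have weight: "norm (x k) \<le> d_norm p x * real (n + 1) powr (- r) * real (Suc (n - k))"
    if "k \<le> n" for k
  proof -
    have "norm (x k) \<le> d_norm p x * real (k + 1) powr (- r)"
      using hat_le_d_norm[OF p x, of k] d_spaceD(5)[OF x, of k] by (simp add: r_def)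
    also have "real (k + 1) powr (- r) \<le> real (n + 1) powr (- r) * real (Suc (n - k))"
    proof -
      have "real (n + 1) \<le> real (k + 1) * real (Suc (n - k))"
        using that mult_left_mono[of "real k" "real n" "real k"]
        by (simp add: algebra_simps of_nat_diff)
      then have "real (n + 1) powr r \<le> (real (k + 1) * real (Suc (n - k))) powr r"
        using r by (intro powr_mono2) auto
      also have "\<dots> = real (k + 1) powr r * real (Suc (n - k)) powr r"
        by (rule powr_mult)
      also have "\<dots> \<le> real (k + 1) powr r * real (Suc (n - k)) powr 1"
        using r by (intro mult_left_mono powr_mono) auto
      finally show ?thesis
        by (simp add: powr_minus field_simps)
    qed
    finally show ?thesis
      using d_norm_nonneg[of p x] by (simp add: mult_left_mono mult.assoc)
  qed
  have geom: "(\<Sum>k=0..n. t ^ (n - k) * real (Suc (n - k))) \<le> 1 / (1 - t)\<^sup>2"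
  proof -
    have "(\<lambda>n. real (Suc n) * t ^ n) sums (1 / (1 - t)\<^sup>2)"
      using geometric_deriv_sums[of t] t by simp
    then have s: "summable (\<lambda>n. real (Suc n) * t ^ n)" "(\<Sum>n. real (Suc n) * t ^ n) = 1 / (1 - t)\<^sup>2"
      by (auto simp: sums_iff)
    have "(\<Sum>k=0..n. t ^ (n - k) * real (Suc (n - k))) = (\<Sum>j=0..n. real (Suc j) * t ^ j)"
      by (rule sum.reindex_bij_witness[of _ "\<lambda>j. n - j" "\<lambda>j. n - j"]) auto
    also have "\<dots> \<le> 1 / (1 - t)\<^sup>2"
      unfolding s(2)[symmetric] using t by (intro sum_le_suminf s(1)) auto
    finally show ?thesis .
  qed
  have "norm (\<Sum>k=0..n. of_real t ^ (n - k) * x k) \<le> (\<Sum>k=0..n. t ^ (n - k) * norm (x k))"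
    using norm_sum[of "\<lambda>k. of_real t ^ (n - k) * x k" "{0..n}"] t
    by (simp add: norm_mult norm_power)
  also have "\<dots> \<le> (\<Sum>k=0..n. t ^ (n - k) * (d_norm p x * real (n + 1) powr (- r) * real (Suc (n - k))))"
    using t weight by (intro sum_mono mult_left_mono) auto
  also have "\<dots> = d_norm p x * real (n + 1) powr (- r) * (\<Sum>k=0..n. t ^ (n - k) * real (Suc (n - k)))"
    by (simp only: sum_distrib_left mult.left_commute)
  also have "\<dots> \<le> d_norm p x * real (n + 1) powr (- r) * (1 / (1 - t)\<^sup>2)"
    using geom d_norm_nonneg by (intro mult_left_mono) auto
  finally have sum: "norm (\<Sum>k=0..n. of_real t ^ (n - k) * x k)
      \<le> d_norm p x * real (n + 1) powr (- r) * (1 / (1 - t)\<^sup>2)" .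
  have "norm (cesaro t x n) = norm (\<Sum>k=0..n. of_real t ^ (n - k) * x k) / real (n + 1)"
    unfolding cesaro_def norm_mult norm_divide norm_of_nat by simp
  also have "\<dots> \<le> d_norm p x * real (n + 1) powr (- r) * (1 / (1 - t)\<^sup>2) / real (n + 1)"
    using sum by (rule divide_right_mono) simp
  also have "\<dots> = d_norm p x / (1 - t)\<^sup>2 * real (n + 1) powr (- 1 - r)"
    by (simp add: powr_diff powr_minus field_simps)
  finally show ?thesis by (simp add: r_def)
qed

lemma powr_lp:
  assumes p: "1 \<le> p" and s: "1 / p < s" and C: "0 \<le> C"
  shows "(\<lambda>n. C * real (n + 1) powr (- s)) \<in> lp_space p"
    and "decseq (\<lambda>n. C * real (n + 1) powr (- s))"
proof -
  have s0: "0 < s" using p s by (meson divide_nonneg_nonneg le_less_trans order.trans zero_le_one)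
  have "- (s * p) < -1" using p s by (simp add: field_simps)
  then have "summable (\<lambda>n. real (n + 1) powr (- (s * p)))"
    by (subst summable_Suc_iff[of "\<lambda>n. real n powr (- (s * p))", simplified Suc_eq_plus1])
      (simp add: summable_real_powr_iff)
  then have "(\<lambda>n. real (n + 1) powr (- s)) \<in> lp_space p"
    by (simp add: lp_space_def powr_powr)
  then show "(\<lambda>n. C * real (n + 1) powr (- s)) \<in> lp_space p"
    by (rule lp_scale(1)[OF p])
  show "decseq (\<lambda>n. C * real (n + 1) powr (- s))"
    using C s0 by (auto simp: decseq_def intro!: mult_left_mono powr_mono2')
qed

lemma cesaro_compact:
  assumes p: "1 \<le> p" and t: "0 \<le> t" "t < 1"
  shows "compact_operator (d_space p) (d_norm p) (cesaro t)"
proof -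
  interpret d: Metric_space "d_space p" "\<lambda>x y. d_norm p (\<lambda>n. x n - y n)"
    by (rule d_space_Metric_space[OF p])
  define w where "w = (\<lambda>n. 1 / (1 - t)\<^sup>2 * real (n + 1) powr (- (1 + 1 / p)))"
  let ?K = "{x. \<forall>n. norm (x n) \<le> w n}"
  have K: "compactin d.mtopology ?K"
    using compactin_order_interval[OF p] powr_lp[OF p, of "1 + 1 / p" "1 / (1 - t)\<^sup>2"]
    by (simp add: w_def norm_topology_def)
  have "cesaro t x \<in> ?K" if x: "x \<in> d_space p" "d_norm p x \<le> 1" for x
  proof (clarify)
    fix n
    have "norm (cesaro t x n) \<le> d_norm p x / (1 - t)\<^sup>2 * real (n + 1) powr (- 1 - 1 / p)"
      by (rule cesaro_decay[OF p t x(1)])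
    also have "\<dots> \<le> 1 / (1 - t)\<^sup>2 * real (n + 1) powr (- 1 - 1 / p)"
      using x(2) by (intro mult_right_mono divide_right_mono) auto
    finally show "norm (cesaro t x n) \<le> w n" by (simp add: w_def)
  qed
  then have "cesaro t ` {x \<in> d_space p. d_norm p x \<le> 1} \<subseteq> ?K" by blast
  moreover have "closedin d.mtopology ?K"
    by (rule compactin_imp_closedin[OF d.Hausdorff_space_mtopology K])
  ultimately have "d.mtopology closure_of (cesaro t ` {x \<in> d_space p. d_norm p x \<le> 1}) \<subseteq> ?K"
    by (rule closure_of_minimal)
  from closed_compactin[OF K this closedin_closure_of]
  show ?thesis
    using cesaro_continuous[OF p t] by (simp add: compact_operator_def norm_topology_def)
qed

section \<open>Eigenvalues\<close>

lemma Lambda_iff: "\<mu> \<in> Lambda \<longleftrightarrow> (\<exists>n::nat. \<mu> * of_nat (n + 1) = 1)"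
proof -
  have "\<mu> = 1 / of_nat (n + 1) \<longleftrightarrow> \<mu> * of_nat (n + 1) = 1" for n
    using of_nat_neq_0[of n, where 'a = complex] by (simp add: eq_divide_eq del: of_nat_Suc)
  then show ?thesis unfolding Lambda_def by blast
qed

lemma zero_notin_Lambda: "0 \<notin> Lambda"
  by (simp add: Lambda_iff)

text \<open>
  The shifted operator is lower triangular with diagonal entries \<open>1 / (n + 1) - \<mu>\<close>, so a sequence is
  recovered from its image term by term.
\<close>

lemma shifted_cesaro_inj:
  assumes "\<mu> \<notin> Lambda"
  shows "inj_on (shifted_operator (cesaro t) \<mu>) A"
proof (rule inj_onI)
  fix x y assume "shifted_operator (cesaro t) \<mu> x = shifted_operator (cesaro t) \<mu> y"
  then have eq: "cesaro t x n - \<mu> * x n = cesaro t y n - \<mu> * y n" for n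
    unfolding shifted_operator_def by meson
  have nz: "1 - \<mu> * of_nat (n + 1) \<noteq> 0" for n
    using assms by (auto simp: Lambda_iff)
  have "x n = y n \<and> cesaro t x n = cesaro t y n" for n
  proof (induction n)
    case 0
    have "(1 - \<mu>) * x 0 = (1 - \<mu>) * y 0"
      using eq[of 0] by (simp add: cesaro_0 algebra_simps)
    then show ?case using nz[of 0] by (simp add: cesaro_0)
  next
    case (Suc n)
    define m :: complex where "m = of_nat (n + 2)"
    have m: "m \<noteq> 0" "1 - \<mu> * m \<noteq> 0"
      using nz[of "Suc n"] of_nat_neq_0[of "Suc n", where 'a = complex]
      by (auto simp: m_def simp del: of_nat_Suc)
    have "(d + x (Suc n)) / m - \<mu> * x (Suc n) = (d + y (Suc n)) / m - \<mu> * y (Suc n)"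
      if "d = of_real t * of_nat (n + 1) * cesaro t y n" for d
      using eq[of "Suc n"] Suc.IH unfolding cesaro_Suc m_def that by simp
    then have "(1 - \<mu> * m) * x (Suc n) = (1 - \<mu> * m) * y (Suc n)"
      using m(1) by (simp add: field_simps)
    then have "x (Suc n) = y (Suc n)" using m(2) by simp
    then show ?case using Suc.IH by (simp add: cesaro_Suc)
  qed
  then show "x = y" by blast
qed

lemma geometric_lp:
  fixes q :: real
  assumes p: "1 \<le> p" and q: "0 < q" "q < 1"
  shows "(\<lambda>n. q ^ n) \<in> lp_space p"
proof -
  have "norm (q ^ n) powr p = (q powr p) ^ n" for n
    using q by (simp add: powr_powr mult.commute flip: powr_realpow)
  moreover have "q powr p < 1"
    using p q powr_less_mono2[of p q 1] by simp
  ultimately show ?thesis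
    using q by (simp add: lp_space_def)
qed

text \<open>
  The recursion for the means turns the eigenvalue equation into \<open>(n + 1 - m) x\<^sub>n\<^sub>+\<^sub>1 = t (n + 1) x\<^sub>n\<close>, the
  absorption identity for binomial coefficients. For membership in \<open>d\<^sub>p\<close>, note that \<open>(n choose m) s\<^sup>m t\<^sup>n\<^sup>-\<^sup>m\<close> is one
  of the terms of the binomial expansion of \<open>(s + t)\<^sup>n\<close>; any \<open>s > 0\<close> with \<open>s + t < 1\<close> gives a geometric bound.
\<close>

lemma cesaro_eigenvector:
  fixes m :: nat
  assumes p: "1 \<le> p" and t: "0 \<le> t" "t < 1"
  defines "x \<equiv> \<lambda>n. of_nat (n choose m) * of_real t ^ (n - m)"
  shows "x \<in> d_space p" and "cesaro t x = (\<lambda>n. 1 / of_nat (m + 1) * x n)" and "x m = 1"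
proof -
  show "x m = 1" by (simp add: x_def)
  define s where "s = (1 - t) / 2"
  have s: "0 < s" "0 < s + t" "s + t < 1"
    using t by (auto simp: s_def field_simps)
  define w where "w = (\<lambda>n. (1 / s ^ m) * (s + t) ^ n)"
  show "x \<in> d_space p"
  proof (rule d_space_dominated(1)[OF p])
    show "w \<in> lp_space p"
      unfolding w_def by (rule lp_scale(1)[OF p geometric_lp[OF p s(2,3)]])
    show "decseq w"
      using s by (auto simp: w_def decseq_def intro!: divide_right_mono power_decreasing)
    show "norm (x n) \<le> w n" for n
    proof (cases "m \<le> n")
      case True
      have "real (n choose m) * s ^ m * t ^ (n - m) \<le> (\<Sum>k\<le>n. real (n choose k) * s ^ k * t ^ (n - k))"
        using True s t by (intro member_le_sum) auto
      also have "\<dots> = (s + t) ^ n"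
        by (simp add: binomial_ring)
      finally show ?thesis
        using s t by (simp add: x_def w_def norm_mult norm_power field_simps)
    next
      case False
      then show ?thesis using s by (simp add: x_def w_def binomial_eq_0)
    qed
  qed
  show "cesaro t x = (\<lambda>n. 1 / of_nat (m + 1) * x n)"
  proof (rule cesaro_unique)
    show "1 / of_nat (m + 1) * x 0 = x 0"
      by (cases m) (auto simp: x_def)
    fix n
    define c :: complex where "c = of_nat (m + 1)"
    have c: "c \<noteq> 0"
      using of_nat_neq_0[of m, where 'a = complex] by (simp add: c_def del: of_nat_Suc)
    have "(of_nat (n + 2) - c) * x (Suc n) = of_real t * of_nat (n + 1) * x n"
    proof (cases "m \<le> n")
      case True
      have "(Suc n - m) * (Suc n choose m) = Suc n * (n choose m)"
        using binomial_absorb_comp[of "Suc n" m] by simp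
      then have "(of_nat ((Suc n - m) * (Suc n choose m)) :: complex) = of_nat (Suc n * (n choose m))"
        by (rule arg_cong)
      moreover have "of_nat (Suc n - m) = of_nat (n + 2) - c"
        using True by (simp add: c_def of_nat_diff)
      ultimately have id: "(of_nat (n + 2) - c) * of_nat (Suc n choose m)
          = of_nat (n + 1) * of_nat (n choose m)"
        by (simp only: of_nat_mult Suc_eq_plus1)
      have "(of_nat (n + 2) - c) * x (Suc n)
          = ((of_nat (n + 2) - c) * of_nat (Suc n choose m)) * (of_real t * of_real t ^ (n - m))"
        using True by (simp add: x_def Suc_diff_le)
      also have "\<dots> = of_real t * of_nat (n + 1) * x n"
        unfolding id by (simp add: x_def)
      finally show ?thesis .
    next
      case False
      then show ?thesis
        by (cases "m = Suc n") (auto simp: x_def c_def binomial_eq_0)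
    qed
    then show "of_nat (n + 2) * (1 / of_nat (m + 1) * x (Suc n))
        = of_real t * of_nat (n + 1) * (1 / of_nat (m + 1) * x n) + x (Suc n)"
      unfolding c_def[symmetric] using c by (simp add: field_simps)
  qed
qed

lemma shifted_cesaro_not_inj:
  assumes p: "1 \<le> p" and t: "0 \<le> t" "t < 1" and \<mu>: "\<mu> \<in> Lambda"
  shows "\<not> inj_on (shifted_operator (cesaro t) \<mu>) (d_space p)"
proof
  obtain m :: nat where m: "\<mu> = 1 / of_nat (m + 1)"
    using \<mu> by (auto simp: Lambda_def)
  define x :: cseq where "x = (\<lambda>n. of_nat (n choose m) * of_real t ^ (n - m))"
  have eig: "x \<in> d_space p" "cesaro t x = (\<lambda>n. 1 / of_nat (m + 1) * x n)" "x m = 1"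
    using cesaro_eigenvector[OF p t, of m] by (simp_all add: x_def)
  assume "inj_on (shifted_operator (cesaro t) \<mu>) (d_space p)"
  moreover have "shifted_operator (cesaro t) \<mu> x = shifted_operator (cesaro t) \<mu> (\<lambda>n. 0)"
    unfolding shifted_operator_def eig(2) m by (simp add: cesaro_def)
  moreover have "(\<lambda>n. 0) \<in> d_space p"
    by (rule d_space_finite_support[OF p]) simp
  ultimately have "x = (\<lambda>n. 0)"
    using eig(1) by (meson inj_onD)
  then show False using eig(3) by simp
qed

section \<open>The range of the operator\<close>

lemma shifted_cesaro_0: "shifted_operator (cesaro t) 0 = cesaro t"
  by (simp add: shifted_operator_def fun_eq_iff)

text \<open>
  Solving the recursion for the argument, \<open>x\<^sub>n = (n + 1) u\<^sub>n - t n u\<^sub>n\<^sub>-\<^sub>1\<close>, produces a finitely supported preimage of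
  every finitely supported \<open>u\<close>.
\<close>

lemma cesaro_range_dense:
  assumes p: "1 \<le> p" and t: "0 \<le> t" "t < 1"
  shows "norm_topology (d_space p) (d_norm p) closure_of (cesaro t ` d_space p) = d_space p"
proof (rule d_closure_finite_support[OF p])
  show "cesaro t ` d_space p \<subseteq> d_space p"
    using cesaro_d_space(1)[OF p t] by blast
  fix u :: cseq and m assume u: "\<And>n. m \<le> n \<Longrightarrow> u n = 0"
  define x where
    "x n = of_nat (n + 1) * u n - of_real t * of_nat n * u (n - 1)" for n
  have "cesaro t x = u"
    by (rule cesaro_unique) (simp_all add: x_def)
  moreover have "x \<in> d_space p"
    by (rule d_space_finite_support[OF p, of "Suc m"]) (simp add: x_def u)
  ultimately show "u \<in> cesaro t ` d_space p" by blast
qed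

text \<open>
  The sequence \<open>(n + 1) powr (- s)\<close> is in \<open>d\<^sub>p\<close> for \<open>s > 1 / p\<close>, whereas the elements of the range decay at
  least like \<open>(n + 1) powr (- 1 - 1 / p)\<close>. Any \<open>s\<close> strictly between these exponents separates the two; the
  midpoint is taken.
\<close>

lemma cesaro_not_surj:
  assumes p: "1 \<le> p" and t: "0 \<le> t" "t < 1"
  shows "cesaro t ` d_space p \<noteq> d_space p"
proof
  assume surj: "cesaro t ` d_space p = d_space p"
  define s where "s = 1 / p + 1 / 2"
  define u :: cseq where "u = (\<lambda>n. of_real (real (n + 1) powr (- s)))"
  have "u \<in> d_space p"
    using d_space_dominated(1)[OF p powr_lp(2,1)[OF p, of s 1], of u] by (simp add: s_def u_def)
  then obtain x where x: "x \<in> d_space p" "u = cesaro t x"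
    using surj by blast
  define K where "K = d_norm p x / (1 - t)\<^sup>2"
  have le: "sqrt (real (n + 1)) \<le> K" for n
  proof -
    have "real (n + 1) powr (- s) \<le> K * real (n + 1) powr (- 1 - 1 / p)"
      using cesaro_decay[OF p t x(1), of n] by (simp add: x(2)[symmetric] u_def K_def)
    then have "real (n + 1) powr (- s) * real (n + 1) powr (1 + 1 / p)
        \<le> K * real (n + 1) powr (- 1 - 1 / p) * real (n + 1) powr (1 + 1 / p)"
      by (rule mult_right_mono) simp
    then show ?thesis
      by (simp add: s_def powr_half_sqrt mult.assoc flip: powr_add)
  qed
  have "real (n + 1) \<le> K\<^sup>2" for n
    using power_mono[OF le, of n 2] by simp
  moreover obtain n where "K\<^sup>2 < real n"
    using reals_Archimedean2 by blast
  ultimately have "real (n + 1) < real n"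
    by (rule le_less_trans)
  then show False by simp
qed

section \<open>The resolvent\<close>

text \<open>
  If \<open>C\<^sub>t x - \<mu> x = y\<close>, then substituting \<open>\<mu> x = u - y\<close> into the recursion for \<open>u = C\<^sub>t x\<close> gives
  \<open>(1 - \<mu> (n + 1)) u\<^sub>n = y\<^sub>n - \<mu> t n u\<^sub>n\<^sub>-\<^sub>1\<close>. This defines \<open>u\<close> directly from \<open>y\<close>.
\<close>

primrec resolvent_mean :: "real \<Rightarrow> complex \<Rightarrow> cseq \<Rightarrow> cseq" where
  "resolvent_mean t \<mu> y 0 = y 0 / (1 - \<mu>)"
| "resolvent_mean t \<mu> y (Suc n) =
    (y (Suc n) - \<mu> * of_real t * of_nat (n + 1) * resolvent_mean t \<mu> y n) / (1 - \<mu> * of_nat (n + 2))"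

definition cesaro_resolvent :: "real \<Rightarrow> complex \<Rightarrow> cseq \<Rightarrow> cseq" where
  "cesaro_resolvent t \<mu> y = (\<lambda>n. 1 / \<mu> * (resolvent_mean t \<mu> y n - y n))"

context
  fixes t :: real and \<mu> :: complex
  assumes \<mu>: "\<mu> \<notin> Lambda" "\<mu> \<noteq> 0"
begin

lemma denominator_nonzero: "1 - \<mu> \<noteq> 0" "1 - \<mu> * of_nat (n + 2) \<noteq> 0"
proof -
  have "1 - \<mu> * of_nat (k + 1) \<noteq> 0" for k
    using \<mu>(1) by (auto simp: Lambda_iff)
  from this[of 0] this[of "n + 1"] show "1 - \<mu> \<noteq> 0" "1 - \<mu> * of_nat (n + 2) \<noteq> 0"
    by (simp_all add: numeral_2_eq_2)
qed

lemma cesaro_cesaro_resolvent: "cesaro t (cesaro_resolvent t \<mu> y) = resolvent_mean t \<mu> y"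
proof (rule cesaro_unique)
  show "resolvent_mean t \<mu> y 0 = cesaro_resolvent t \<mu> y 0"
    using denominator_nonzero(1) \<mu>(2) by (simp add: cesaro_resolvent_def field_simps)
  fix n
  let ?u = "resolvent_mean t \<mu> y"
  have "(1 - \<mu> * of_nat (n + 2)) * ?u (Suc n) = y (Suc n) - \<mu> * of_real t * of_nat (n + 1) * ?u n"
    using denominator_nonzero(2)[of n] by simp
  then have "\<mu> * (of_nat (n + 2) * ?u (Suc n)) =
      \<mu> * (of_real t * of_nat (n + 1) * ?u n) + (?u (Suc n) - y (Suc n))"
    by (simp add: algebra_simps del: resolvent_mean.simps)
  then show "of_nat (n + 2) * ?u (Suc n) =
      of_real t * of_nat (n + 1) * ?u n + cesaro_resolvent t \<mu> y (Suc n)"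
    using \<mu>(2) by (simp add: cesaro_resolvent_def field_simps del: resolvent_mean.simps)
qed

lemma shifted_cesaro_resolvent:
  "shifted_operator (cesaro t) \<mu> (cesaro_resolvent t \<mu> y) = y"
  unfolding shifted_operator_def cesaro_cesaro_resolvent
  using \<mu>(2) by (simp add: cesaro_resolvent_def fun_eq_iff)

lemma cesaro_resolvent_shifted:
  "cesaro_resolvent t \<mu> (shifted_operator (cesaro t) \<mu> x) = x"
proof (rule inj_onD[where f = "shifted_operator (cesaro t) \<mu>" and A = UNIV])
  show "inj_on (shifted_operator (cesaro t) \<mu>) UNIV"
    by (rule shifted_cesaro_inj[OF \<mu>(1)])
qed (simp_all add: shifted_cesaro_resolvent)

text \<open>
  The two conditions on \<open>D\<close> compare, coefficient by coefficient, one step of the recursion for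
  \<open>resolvent_mean\<close> with one step of the recursion for \<open>cesaro_real q\<close>. They allow \<open>D = C\<close> as soon as the ratio
  \<open>\<bar>\<mu>\<bar> t m / \<bar>1 - \<mu> m\<bar>\<close>, with \<open>m = n + 2\<close>, has dropped below \<open>q\<close> and \<open>C\<close> is at least \<open>m / \<bar>1 - \<mu> m\<bar>\<close>.
\<close>

lemma resolvent_mean_step:
  fixes v a :: real
  assumes t: "0 \<le> t" and q: "0 < q" and C: "0 \<le> C"
    and D: "real (n + 2) \<le> D * norm (1 - \<mu> * of_nat (n + 2))"
      "C * (norm \<mu> * t * real (n + 2)) \<le> D * (q * norm (1 - \<mu> * of_nat (n + 2)))"
    and v: "0 \<le> v" "norm (resolvent_mean t \<mu> y n) \<le> C * v" and a: "norm (y (Suc n)) \<le> a"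
  shows "norm (resolvent_mean t \<mu> y (Suc n)) \<le> D * ((q * real (n + 1) * v + a) / real (n + 2))"
proof -
  define d where "d = norm (1 - \<mu> * of_nat (n + 2))"
  have d: "0 < d" using denominator_nonzero(2)[of n] by (simp add: d_def)
  have a0: "0 \<le> a" using a norm_ge_zero[of "y (Suc n)"] by linarith
  define m where "m = real (n + 2)"
  have m: "0 < m" by (simp add: m_def)
  have D': "m \<le> D * d" "C * (norm \<mu> * t * m) \<le> D * (q * d)"
    using D by (auto simp: d_def m_def)
  have "norm (y (Suc n) - \<mu> * of_real t * of_nat (n + 1) * resolvent_mean t \<mu> y n)
      \<le> norm (y (Suc n)) + norm (\<mu> * of_real t * of_nat (n + 1) * resolvent_mean t \<mu> y n)"
    by (rule norm_triangle_ineq4)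
  also have "norm (\<mu> * of_real t * of_nat (n + 1) * resolvent_mean t \<mu> y n)
      = norm \<mu> * t * real (n + 1) * norm (resolvent_mean t \<mu> y n)"
    using t by (simp only: norm_mult norm_of_real norm_of_nat abs_of_nonneg)
  also have "\<dots> \<le> norm \<mu> * t * real (n + 1) * (C * v)"
    using v(2) t by (intro mult_left_mono) auto
  finally have "m * norm (y (Suc n) - \<mu> * of_real t * of_nat (n + 1) * resolvent_mean t \<mu> y n)
      \<le> m * (a + norm \<mu> * t * real (n + 1) * (C * v))"
    using a m by (intro mult_left_mono) auto
  also have "\<dots> = m * a + (C * (norm \<mu> * t * m)) * (real (n + 1) * v)"
    by (simp add: algebra_simps)
  also have "\<dots> \<le> D * d * a + D * (q * d) * (real (n + 1) * v)"
    using D' a0 v(1) by (intro add_mono mult_right_mono) auto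
  also have "\<dots> = D * (q * real (n + 1) * v + a) * d"
    by (simp add: algebra_simps)
  finally show ?thesis
    unfolding resolvent_mean.simps norm_divide d_def[symmetric] m_def[symmetric]
    using d m by (simp only: pos_divide_le_eq pos_le_divide_eq times_divide_eq_right times_divide_eq_left mult.commute)
qed

text \<open>
  As \<open>m\<close> grows, \<open>\<bar>\<mu>\<bar> t m / \<bar>1 - \<mu> m\<bar>\<close> tends to \<open>t < q\<close> and \<open>m / \<bar>1 - \<mu> m\<bar>\<close> tends to \<open>1 / \<bar>\<mu>\<bar>\<close>. So from some
  index \<open>N\<close> on, any constant above \<open>2 / \<bar>\<mu>\<bar>\<close> is preserved by the recursion step; below \<open>N\<close>, each step may enlarge it, but only
  finitely often.
\<close>

lemma resolvent_mean_bound: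
  assumes t: "0 \<le> t" "t < q"
  obtains C where "0 \<le> C" and "\<And>y a n. (\<And>k. norm (y k) \<le> a k) \<Longrightarrow>
    norm (resolvent_mean t \<mu> y n) \<le> C * cesaro_real q a n"
proof -
  have q: "0 < q" using t by simp
  let ?d = "\<lambda>n. norm (1 - \<mu> * of_nat (n + 2))"
  define B where "B = (\<lambda>C n. \<forall>y a. (\<forall>k. norm (y k) \<le> a k) \<longrightarrow>
    norm (resolvent_mean t \<mu> y n) \<le> C * cesaro_real q a n)"
  have a0: "0 \<le> cesaro_real q a n" if "\<forall>k. norm (y k :: complex) \<le> a k" for y a n
    using q by (intro cesaro_real_nonneg) (auto intro: order_trans[OF norm_ge_zero that[rule_format]])
  have step: "B D (Suc n)" if "B C n" "0 \<le> C" "real (n + 2) \<le> D * ?d n"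
    "C * (norm \<mu> * t * real (n + 2)) \<le> D * (q * ?d n)" for C D n
    using resolvent_mean_step[OF t(1) q that(2,3,4)] that(1) a0
    unfolding B_def cesaro_real.simps by blast
  have B_mono: "B D n" if "B C n" "C \<le> D" for C D n
    unfolding B_def
  proof (intro allI impI)
    fix y :: cseq and a assume ya: "\<forall>k. norm (y k) \<le> a k"
    then have "norm (resolvent_mean t \<mu> y n) \<le> C * cesaro_real q a n"
      using that(1) by (simp add: B_def)
    also have "\<dots> \<le> D * cesaro_real q a n"
      using that(2) a0[OF ya] by (rule mult_right_mono)
    finally show "norm (resolvent_mean t \<mu> y n) \<le> D * cesaro_real q a n" .
  qed
  have finite: "\<exists>C\<ge>0. B C n" for n
  proof (induction n)
    case 0
    have "B (1 / norm (1 - \<mu>)) 0"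
      by (auto simp: B_def norm_divide intro!: divide_right_mono)
    then show ?case by (intro exI[of _ "1 / norm (1 - \<mu>)"]) simp
  next
    case (Suc n)
    then obtain C where C: "0 \<le> C" "B C n" by blast
    define D where "D = real (n + 2) / ?d n + C * (norm \<mu> * t * real (n + 2)) / (q * ?d n)"
    have d: "0 < ?d n" using denominator_nonzero(2)[of n] by simp
    have nonneg: "0 \<le> real (n + 2) / ?d n" "0 \<le> C * (norm \<mu> * t * real (n + 2)) / (q * ?d n)"
      using C t q d by auto
    have "real (n + 2) \<le> D * ?d n"
      using nonneg(2) d by (subst pos_divide_le_eq[symmetric]) (simp_all add: D_def)
    moreover have "C * (norm \<mu> * t * real (n + 2)) \<le> D * (q * ?d n)"
      using nonneg(1) d q by (subst pos_divide_le_eq[symmetric]) (simp_all add: D_def)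
    ultimately have "B D (Suc n)"
      using step C by blast
    moreover have "0 \<le> D"
      unfolding D_def using nonneg by (rule add_nonneg_nonneg)
    ultimately show ?case by blast
  qed
  (* The first entry of the maximum makes \<bar>1 - \<mu> m\<bar> at least \<bar>\<mu>\<bar> m / 2; the second one makes
     q (\<bar>\<mu>\<bar> m - 1) at least \<bar>\<mu>\<bar> t m. *)
  define r where "r = max (2 / norm \<mu>) (q / (norm \<mu> * (q - t)))"
  obtain N :: nat where N: "r \<le> real N"
    using real_arch_simple by blast
  have large: "real (n + 2) \<le> 2 / norm \<mu> * ?d n" "norm \<mu> * t * real (n + 2) \<le> q * ?d n"
    if "N \<le> n" for n
  proof -
    define m where "m = real (n + 2)"
    have m: "r \<le> m" using N that by (simp add: m_def)
    have \<mu>0: "0 < norm \<mu>" using \<mu>(2) by simp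
    have d: "norm \<mu> * m - 1 \<le> ?d n"
      using norm_triangle_ineq2[of "\<mu> * of_nat (n + 2)" 1]
      unfolding norm_minus_commute[of _ "1 :: complex"] norm_mult norm_of_nat m_def by simp
    have "2 / norm \<mu> \<le> m" "q / (norm \<mu> * (q - t)) \<le> m"
      using m by (auto simp: r_def)
    then have "2 \<le> norm \<mu> * m" "q \<le> norm \<mu> * m * (q - t)"
      using \<mu>0 t by (auto simp: pos_divide_le_eq mult_ac)
    then have "norm \<mu> * m \<le> 2 * ?d n" "norm \<mu> * m * t \<le> q * (norm \<mu> * m - 1)"
      using d by (auto simp: algebra_simps)
    moreover have "q * (norm \<mu> * m - 1) \<le> q * ?d n"
      using d q by simp
    ultimately have "m \<le> 2 * ?d n / norm \<mu>" "norm \<mu> * t * m \<le> q * ?d n"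
      using \<mu>0 by (auto simp: pos_le_divide_eq mult_ac)
    then show "real (n + 2) \<le> 2 / norm \<mu> * ?d n" "norm \<mu> * t * real (n + 2) \<le> q * ?d n"
      unfolding m_def by simp_all
  qed
  obtain c where c: "\<And>n. 0 \<le> c n" "\<And>n. B (c n) n"
    using finite by metis
  define C where "C = (\<Sum>n\<le>N. c n) + 2 / norm \<mu>"
  have "0 \<le> (\<Sum>n\<le>N. c n)" by (intro sum_nonneg c(1))
  moreover have "c n \<le> (\<Sum>n\<le>N. c n)" if "n \<le> N" for n
    using that c(1) by (intro member_le_sum) auto
  ultimately have C: "0 \<le> C" "2 / norm \<mu> \<le> C" "\<And>n. n \<le> N \<Longrightarrow> c n \<le> C"
    by (auto simp: C_def add_increasing2)
  have "B C n" for n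
  proof (induction n)
    case 0
    show ?case using B_mono c(2) C(3) by blast
  next
    case (Suc n)
    show ?case
    proof (cases "Suc n \<le> N")
      case True
      then show ?thesis using B_mono c(2) C(3) by blast
    next
      case False
      then have n: "N \<le> n" by simp
      have "real (n + 2) \<le> 2 / norm \<mu> * ?d n" by (rule large(1)[OF n])
      also have "\<dots> \<le> C * ?d n" using C(2) by (rule mult_right_mono) simp
      finally have "real (n + 2) \<le> C * ?d n" .
      moreover have "C * (norm \<mu> * t * real (n + 2)) \<le> C * (q * ?d n)"
        using large(2)[OF n] C(1) by (rule mult_left_mono)
      ultimately show ?thesis using step[OF Suc C(1)] by blast
    qed
  qed
  then show thesis using that[OF C(1)] by (auto simp: B_def)
qed

lemma resolvent_mean_add:
  "resolvent_mean t \<mu> (\<lambda>n. x n + y n) n = resolvent_mean t \<mu> x n + resolvent_mean t \<mu> y n"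
  by (induction n) (simp_all add: add_divide_distrib diff_divide_distrib algebra_simps)

lemma resolvent_mean_scale:
  "resolvent_mean t \<mu> (\<lambda>n. c * y n) n = c * resolvent_mean t \<mu> y n"
  by (induction n) (simp_all add: algebra_simps)

lemma cesaro_resolvent_continuous:
  assumes p: "1 \<le> p" and t: "0 \<le> t" "t < 1"
  shows "cesaro_resolvent t \<mu> \<in> continuous_linear_operators (d_space p) (d_norm p)"
proof -
  define q where "q = (1 + t) / 2"
  have q: "0 \<le> q" "t < q" "q < 1" using t by (auto simp: q_def)
  obtain C where C: "0 \<le> C" and bound: "\<And>y a n. (\<And>k. norm (y k) \<le> a k) \<Longrightarrow>
      norm (resolvent_mean t \<mu> y n) \<le> C * cesaro_real q a n"
    using resolvent_mean_bound[OF t(1) q(2)] by blast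
  define K where "K = norm (1 / \<mu>) * (C / (1 - q) + 1)"
  have main: "cesaro_resolvent t \<mu> y \<in> d_space p \<and> d_norm p (cesaro_resolvent t \<mu> y) \<le> K * d_norm p y"
    if y: "y \<in> d_space p" for y
  proof -
    have u: "resolvent_mean t \<mu> y \<in> d_space p"
      "d_norm p (resolvent_mean t \<mu> y) \<le> C / (1 - q) * d_norm p y"
      using d_space_cesaro_dominated[OF p q(1,3) y C bound[OF d_spaceD(5)[OF y]]] by auto
    note diff = d_space_diff[OF p u(1) y]
    note scale = d_space_scale[OF p diff(1), of "1 / \<mu>"]
    have "d_norm p (cesaro_resolvent t \<mu> y)
        \<le> norm (1 / \<mu>) * d_norm p (\<lambda>n. resolvent_mean t \<mu> y n - y n)"
      using scale(2) by (simp add: cesaro_resolvent_def)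
    also have "\<dots> \<le> norm (1 / \<mu>) * (C / (1 - q) * d_norm p y + d_norm p y)"
      using diff(2) u(2) by (intro mult_left_mono) auto
    finally show ?thesis
      using scale(1) by (simp add: cesaro_resolvent_def K_def distrib_left distrib_right mult.assoc)
  qed
  show ?thesis
  proof (rule d_bounded_operator[OF p, where K = K])
    show "cesaro_resolvent t \<mu> (\<lambda>n. x n + y n)
        = (\<lambda>n. cesaro_resolvent t \<mu> x n + cesaro_resolvent t \<mu> y n)" for x y
      by (simp add: cesaro_resolvent_def resolvent_mean_add fun_eq_iff algebra_simps)
    show "cesaro_resolvent t \<mu> (\<lambda>n. c * x n) = (\<lambda>n. c * cesaro_resolvent t \<mu> x n)" for c x
      by (simp add: cesaro_resolvent_def resolvent_mean_scale fun_eq_iff algebra_simps)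
  qed (use main in auto)
qed

lemma shifted_cesaro_invertible:
  assumes p: "1 \<le> p" and t: "0 \<le> t" "t < 1"
  shows "invertible_operator (d_space p) (d_norm p) (shifted_operator (cesaro t) \<mu>)"
  unfolding invertible_operator_def
  using cesaro_resolvent_continuous[OF assms] cesaro_resolvent_shifted shifted_cesaro_resolvent
  by blast

end

section \<open>The fine spectra\<close>

lemma shifted_cesaro_maps:
  assumes p: "1 \<le> p" and t: "0 \<le> t" "t < 1" and x: "x \<in> d_space p"
  shows "shifted_operator (cesaro t) \<mu> x \<in> d_space p"
  unfolding shifted_operator_def
  by (rule d_space_diff(1)[OF p cesaro_d_space(1)[OF p t x] d_space_scale(1)[OF p x]])

lemma invertible_imp_bij_betw:
  assumes "invertible_operator X N T" "T ` X \<subseteq> X"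
  shows "bij_betw T X X"
proof -
  obtain S where "S ` X \<subseteq> X" "\<forall>x\<in>X. S (T x) = x \<and> T (S x) = x"
    using assms(1) by (auto simp: invertible_operator_def continuous_linear_operators_def)
  then show ?thesis
    using assms(2) by (intro bij_betw_byWitness[of _ S]) auto
qed

theorem theorem4p19:
  fixes t p :: real
  assumes "0 \<le> t" and "t < 1" and "1 \<le> p"
  shows "cesaro t \<in> continuous_linear_operators (d_space p) (d_norm p) \<and>
    operator_norm (d_space p) (d_norm p) (cesaro t) \<le> (1 - t) powr (- 1 - 1 / p) \<and>
    compact_operator (d_space p) (d_norm p) (cesaro t) \<and>
    spectrum (d_space p) (d_norm p) (cesaro t) = Lambda \<union> {0} \<and>
    point_spectrum (d_space p) (cesaro t) = Lambda \<and>
    continuous_spectrum (d_space p) (d_norm p) (cesaro t) = {0} \<and>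
    residual_spectrum (d_space p) (d_norm p) (cesaro t) = {}"
proof -
  note t = assms(1,2) and p = assms(3)
  interpret d: Metric_space "d_space p" "\<lambda>x y. d_norm p (\<lambda>n. x n - y n)"
    by (rule d_space_Metric_space[OF p])
  let ?X = "d_space p" and ?N = "d_norm p" and ?T = "shifted_operator (cesaro t)"
  have norm: "operator_norm ?X ?N (cesaro t) \<le> (1 - t) powr (- 1 - 1 / p)"
  proof -
    have "operator_norm ?X ?N (cesaro t) \<le> (1 - t) powr (- 1)"
      using cesaro_operator_norm[OF p t] t by (simp add: powr_minus field_simps)
    also have "\<dots> \<le> (1 - t) powr (- 1 - 1 / p)"
      using t p by (intro powr_mono') auto
    finally show ?thesis .
  qed
  have inj: "inj_on (?T \<mu>) ?X \<longleftrightarrow> \<mu> \<notin> Lambda" for \<mu>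
    using shifted_cesaro_inj shifted_cesaro_not_inj[OF p t] by blast
  have maps: "?T \<mu> ` ?X \<subseteq> ?X" for \<mu>
    using shifted_cesaro_maps[OF p t] by blast
  have inv: "invertible_operator ?X ?N (?T \<mu>) \<longleftrightarrow> \<mu> \<notin> Lambda \<union> {0}" for \<mu>
  proof
    assume "invertible_operator ?X ?N (?T \<mu>)"
    from invertible_imp_bij_betw[OF this maps] show "\<mu> \<notin> Lambda \<union> {0}"
      using cesaro_not_surj[OF p t] inj[of \<mu>] shifted_cesaro_0[of t] by (auto simp: bij_betw_def)
  next
    assume "\<mu> \<notin> Lambda \<union> {0}"
    then show "invertible_operator ?X ?N (?T \<mu>)"
      using shifted_cesaro_invertible[OF _ _ p t] by blast
  qed
  have surj: "?T \<mu> ` ?X = ?X" if "\<mu> \<notin> Lambda" "\<mu> \<noteq> 0" for \<mu>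
    using invertible_imp_bij_betw[OF _ maps] inv[of \<mu>] that by (auto simp: bij_betw_def)
  have zero: "?T 0 ` ?X \<noteq> ?X" "norm_topology ?X ?N closure_of (?T 0 ` ?X) = ?X"
    using cesaro_not_surj[OF p t] cesaro_range_dense[OF p t] by (auto simp: shifted_cesaro_0)
  have top: "norm_topology ?X ?N closure_of ?X = ?X"
    using closure_of_topspace[of d.mtopology] by (simp add: norm_topology_def)
  have dense: "norm_topology ?X ?N closure_of (?T \<mu> ` ?X) = ?X" if "\<mu> \<notin> Lambda" for \<mu>
    using that zero(2) surj[of \<mu>] top by (cases "\<mu> = 0") auto
  have "spectrum ?X ?N (cesaro t) = Lambda \<union> {0}" "point_spectrum ?X (cesaro t) = Lambda"
    using inv inj by (auto simp: spectrum_def point_spectrum_def)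
  moreover have "continuous_spectrum ?X ?N (cesaro t) = {0}"
    unfolding continuous_spectrum_def inj
    using zero surj zero_notin_Lambda by auto
  moreover have "residual_spectrum ?X ?N (cesaro t) = {}"
    unfolding residual_spectrum_def inj using dense by auto
  ultimately show ?thesis
    using cesaro_continuous[OF p t] norm cesaro_compact[OF p t] by blast
qed

end
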